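(* Let $N\ge 2$, $w>0$, $X_0>0$, and assume that the asset price process $S$ (on $\mathbb Q$) satisfies (A1) and (A2). Let the weights $g_t$ be defined backwards recursively by $g_{N-1}(k)\,dk:=\delta_w$ (Dirac point measure at $w$) and $$g_t(k):=\int_{[w,\infty)}\Gamma_{t+1}(k'\,|\,k-w)\,g_{t+1}(k')\,dk'\qquad(k>w,\ t=0,\dots,N-2).$$ Let $\tilde S$ (on $\tilde{\mathbb Q}$) be reverse $\Gamma$-adjoint to $S$, and let $Y$ be the multi-contribution fund on $\tilde S$ with regular contribution $w$: $Y_0:=w$, $Y_{t+1}=Y_t\cdot\tilde S_{t+1}/\tilde S_t+w$. Then: (1) For $t=0,\dots,N-1$, the weight $g_t$ is the probability law of $Y_{N-t-1}$: $\tilde{\mathbb Q}(Y_{N-t-1}\in dk)=g_t(k)\,dk$. In particular $g_t$ is a probability density (a probability measure if $t=N-1$) on $[w,\infty)$, and its mean is $$\int_{[w,\infty)}k\,g_t(k)\,dk=\mathbb E^{\tilde{\mathbb Q}}[Y_{N-t-1}]=(N-t)\,w .$$ (2) For $t=0,\dots,N-1$, on $\{\tau>t\}$ and conditional on the fund value $X_t$, the withdrawal guarantee value is $$V_t=\int_{[w,\infty)}P_t(k\,|\,X_t)\,\tilde{\mathbb Q}(Y_{N-t-1}\in dk)=\mathbb E^{\tilde{\mathbb Q}}\big[P_t(Y_{N-t-1}\,|\,X_t)\big],$$ where the expectation is over $Y_{N-t-1}$ with $X_t$ held fixed.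
   Context: Withdrawal times are $0=T_0<T_1<\dots<T_N$ (equidistant). $(S_t)_{t=0,\dots,N}$ is the positive price process of an asset at times $T_t$, under the pricing measure $\mathbb Q$ with filtration $(\mathcal F_t)$; $\mathbb E_t^{\mathbb Q}$ is conditional expectation given $\mathcal F_t$. Interest rates are zero, $S$ is a $\mathbb Q$-martingale, $S_0=1$. For $t<t'$, $P_{t,t'}(K\,|\,s)=\mathbb E^{\mathbb Q}[(K-S_{t'})^+\,|\,S_t=s]$ ($K,s>0$) is the put value at $T_t$ with strike $K$, maturity $T_{t'}$ and spot $s$; $\Gamma_{t,t'}(K\,|\,s)=\partial_s^2P_{t,t'}(K\,|\,s)$. Write $P_t=P_{t,t+1}$, $\Gamma_t=\Gamma_{t,t+1}$. Conditional statements given $S_t=s$ refer to the transition kernels, for all $s>0$. (A1): $S$ is a one-factor Markov process with respect to $(\mathcal F_t)$, and $S_t$ is continuously distributed; as part of this regularity, put values are taken to be twice differentiable in $K$ and in $s$. (A2): $P_t(\alpha K\,|\,\alpha s)=\alpha P_t(K\,|\,s)$ for all $\alpha,K,s>0$ and $t=0,\dots,N-1$ (independent returns). A positive (Markov) process $(\tilde S_t)_{t=0,\dots,N}$ on a probability space with measure $\tilde{\mathbb Q}$ is called reverse $\Gamma$-adjoint to $S$ if for all $t<t'$ in $\{0,\dots,N\}$ and $k,k'>0$ its transition densities are $\tilde{\mathbb Q}(\tilde S_{t'}\in dk'\,|\,\tilde S_t=k)=\Gamma_{N-t',N-t}(k\,|\,k')\,dk'$, where the $\Gamma$'s are those of puts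 on $S$. Withdrawal fund: $X_{t+1}=X_t\cdot S_{t+1}/S_t-w$ for $t=0,\dots,N-1$ (initial value $X_0>0$). Depletion time: $\tau:=\inf\{t: X_t\le 0\}$. Guarantee claims: $Z^{(0)}=0$ and $Z^{(t)}=w\,\mathbf 1_{\tau\le t-1}+X_t^-\,\mathbf 1_{\tau=t}$ for $t=1,\dots,N$, where $x^-=-\min(0,x)$. Guarantee value: $V_t:=\mathbb E_t^{\mathbb Q}\big[\sum_{u=t}^N Z^{(u)}\big]$. *)

theory Defs
  imports "HOL-Probability.Probability"
begin

section \<open>Filtrations, martingales and Markov processes on a finite time grid\<close>

locale finite_filtration = prob_space M
  for M :: "'a measure" +
  fixes F :: "nat \<Rightarrow> 'a measure" and N :: nat
  assumes subalgebra_F: "\<And>t. t \<le> N \<Longrightarrow> subalgebra M (F t)"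
    and F_mono: "\<And>t t'. t \<le> t' \<Longrightarrow> t' \<le> N \<Longrightarrow> subalgebra (F t') (F t)"

definition martingale_upto ::
  "'a measure \<Rightarrow> (nat \<Rightarrow> 'a measure) \<Rightarrow> nat \<Rightarrow> (nat \<Rightarrow> 'a \<Rightarrow> real) \<Rightarrow> bool" where
  "martingale_upto M F N S \<longleftrightarrow> finite_filtration M F N \<and>
     (\<forall>t\<le>N. S t \<in> borel_measurable (F t) \<and> integrable M (S t)) \<and>
     (\<forall>t t'. t \<le> t' \<and> t' \<le> N \<longrightarrow> (AE x in M. real_cond_exp M (F t) (S t') x = S t x))"

text \<open>
  A positive real-valued Markov process with respect to \<open>F\<close>, together with its transition
  kernels: \<open>\<kappa> t t' s\<close> is the conditional law of \<open>S t'\<close> given \<open>S t = s\<close>. The kernels are part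
  of the data, since statements conditional on \<open>S t = s\<close> are meant for every \<open>s > 0\<close> and not
  only for almost every \<open>s\<close> (\<open>S 0\<close>, for instance, may be constant). Values of
  \<open>\<kappa> t t' s\<close> for \<open>s \<le> 0\<close> are irrelevant.
\<close>

locale positive_markov_process = finite_filtration M F N
  for M :: "'a measure" and F :: "nat \<Rightarrow> 'a measure" and N :: nat +
  fixes S :: "nat \<Rightarrow> 'a \<Rightarrow> real"
    and \<kappa> :: "nat \<Rightarrow> nat \<Rightarrow> real \<Rightarrow> real measure"
  assumes adapted: "\<And>t. t \<le> N \<Longrightarrow> S t \<in> borel_measurable (F t)"
    and positive: "\<And>t x. t \<le> N \<Longrightarrow> x \<in> space M \<Longrightarrow> 0 < S t x"
    and kernel: "\<And>t t'. t < t' \<Longrightarrow> t' \<le> N \<Longrightarrow>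
       \<kappa> t t' \<in> measurable (restrict_space borel {0<..}) (prob_algebra borel)"
    and kernel_positive: "\<And>t t' s. t < t' \<Longrightarrow> t' \<le> N \<Longrightarrow> 0 < s \<Longrightarrow>
       emeasure (\<kappa> t t' s) {0<..} = 1"
    and markov: "\<And>t t' A. t < t' \<Longrightarrow> t' \<le> N \<Longrightarrow> A \<in> sets borel \<Longrightarrow>
       AE x in M. real_cond_exp M (F t) (\<lambda>y. indicator A (S t' y)) x = measure (\<kappa> t t' (S t x)) A"
    and chapman_kolmogorov: "\<And>t t' t'' s A. t < t' \<Longrightarrow> t' < t'' \<Longrightarrow> t'' \<le> N \<Longrightarrow> 0 < s \<Longrightarrow>
       A \<in> sets borel \<Longrightarrow>
       emeasure (\<kappa> t t'' s) A = (\<integral>\<^sup>+y\<in>{0<..}. emeasure (\<kappa> t' t'' y) A \<partial>\<kappa> t t' s)"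

definition natural_filtration :: "'a measure \<Rightarrow> (nat \<Rightarrow> 'a \<Rightarrow> real) \<Rightarrow> nat \<Rightarrow> 'a measure" where
  "natural_filtration M S t =
     sigma (space M) {S u -` A \<inter> space M |u A. u \<le> t \<and> A \<in> sets borel}"

section \<open>Put values, assumptions (A1) and (A2), reverse Gamma-adjoint processes\<close>

definition put_value ::
  "(nat \<Rightarrow> nat \<Rightarrow> real \<Rightarrow> real measure) \<Rightarrow> nat \<Rightarrow> nat \<Rightarrow> real \<Rightarrow> real \<Rightarrow> real" where
  "put_value \<kappa> t t' K s = (\<integral>x. max 0 (K - x) \<partial>\<kappa> t t' s)"

definition put_gamma ::
  "(nat \<Rightarrow> nat \<Rightarrow> real \<Rightarrow> real measure) \<Rightarrow> nat \<Rightarrow> nat \<Rightarrow> real \<Rightarrow> real \<Rightarrow> real" where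
  "put_gamma \<kappa> t t' K s = deriv (deriv (\<lambda>s. put_value \<kappa> t t' K s)) s"

definition twice_differentiable_on_pos :: "(real \<Rightarrow> real) \<Rightarrow> bool" where
  "twice_differentiable_on_pos f \<longleftrightarrow>
     (\<forall>x>0. f field_differentiable (at x) \<and> deriv f field_differentiable (at x))"

text \<open>The law of \<open>S 0\<close> is exempt from the density condition because \<open>S 0 = 1\<close>.\<close>

definition A1 ::
  "'a measure \<Rightarrow> (nat \<Rightarrow> 'a measure) \<Rightarrow> nat \<Rightarrow> (nat \<Rightarrow> 'a \<Rightarrow> real) \<Rightarrow>
   (nat \<Rightarrow> nat \<Rightarrow> real \<Rightarrow> real measure) \<Rightarrow> bool" where
  "A1 M F N S \<kappa> \<longleftrightarrow>
     positive_markov_process M F N S \<kappa> \<and>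
     (\<forall>t\<in>{1..N}. \<exists>f. distributed M lborel (S t) f) \<and>
     (\<forall>t t'. t < t' \<and> t' \<le> N \<longrightarrow>
        (\<forall>s>0. twice_differentiable_on_pos (\<lambda>K. put_value \<kappa> t t' K s)) \<and>
        (\<forall>K>0. twice_differentiable_on_pos (\<lambda>s. put_value \<kappa> t t' K s)))"

definition A2 :: "nat \<Rightarrow> (nat \<Rightarrow> nat \<Rightarrow> real \<Rightarrow> real measure) \<Rightarrow> bool" where
  "A2 N \<kappa> \<longleftrightarrow> (\<forall>t<N. \<forall>\<alpha>>0. \<forall>K>0. \<forall>s>0.
     put_value \<kappa> t (t + 1) (\<alpha> * K) (\<alpha> * s) = \<alpha> * put_value \<kappa> t (t + 1) K s)"

text \<open>
  Here \<open>\<kappa>\<close> are the transition kernels of the original process \<open>S\<close>. The Gammas of puts are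
  nonnegative under (A1) and (A2), so \<open>ennreal\<close> does not truncate.
\<close>

definition adjoint_kernel ::
  "nat \<Rightarrow> (nat \<Rightarrow> nat \<Rightarrow> real \<Rightarrow> real measure) \<Rightarrow> nat \<Rightarrow> nat \<Rightarrow> real \<Rightarrow> real measure" where
  "adjoint_kernel N \<kappa> t t' k =
     density lborel (\<lambda>k'. ennreal (put_gamma \<kappa> (N - t') (N - t) k k') * indicator {0<..} k')"

definition reverse_gamma_adjoint ::
  "'b measure \<Rightarrow> nat \<Rightarrow> (nat \<Rightarrow> 'b \<Rightarrow> real) \<Rightarrow> (nat \<Rightarrow> nat \<Rightarrow> real \<Rightarrow> real measure) \<Rightarrow> bool" where
  "reverse_gamma_adjoint M' N S' \<kappa> \<longleftrightarrow>
     positive_markov_process M' (natural_filtration M' S') N S' (adjoint_kernel N \<kappa>)"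

section \<open>The withdrawal fund and its guarantee\<close>

primrec withdrawal_fund :: "real \<Rightarrow> real \<Rightarrow> (nat \<Rightarrow> 'a \<Rightarrow> real) \<Rightarrow> nat \<Rightarrow> 'a \<Rightarrow> real" where
  "withdrawal_fund w x0 S 0 x = x0"
| "withdrawal_fund w x0 S (Suc t) x = withdrawal_fund w x0 S t x * (S (Suc t) x / S t x) - w"

text \<open>The infimum of the empty set is \<open>\<infinity>\<close> in \<open>enat\<close>: the fund is not depleted up to time \<open>N\<close>.\<close>

definition depletion_time :: "nat \<Rightarrow> real \<Rightarrow> real \<Rightarrow> (nat \<Rightarrow> 'a \<Rightarrow> real) \<Rightarrow> 'a \<Rightarrow> enat" where
  "depletion_time N w x0 S x = Inf (enat ` {t. t \<le> N \<and> withdrawal_fund w x0 S t x \<le> 0})"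

definition guarantee_claim ::
  "nat \<Rightarrow> real \<Rightarrow> real \<Rightarrow> (nat \<Rightarrow> 'a \<Rightarrow> real) \<Rightarrow> nat \<Rightarrow> 'a \<Rightarrow> real" where
  "guarantee_claim N w x0 S t x =
     (if t = 0 then 0
      else w * of_bool (depletion_time N w x0 S x \<le> enat (t - 1))
         + (- min 0 (withdrawal_fund w x0 S t x)) * of_bool (depletion_time N w x0 S x = enat t))"

definition guarantee_value ::
  "'a measure \<Rightarrow> (nat \<Rightarrow> 'a measure) \<Rightarrow> nat \<Rightarrow> real \<Rightarrow> real \<Rightarrow> (nat \<Rightarrow> 'a \<Rightarrow> real) \<Rightarrow>
   nat \<Rightarrow> 'a \<Rightarrow> real" where
  "guarantee_value M F N w x0 S t =
     real_cond_exp M (F t) (\<lambda>x. \<Sum>u=t..N. guarantee_claim N w x0 S u x)"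

section \<open>The weights and the multi-contribution fund\<close>

text \<open>
  \<open>weight N w \<kappa> t\<close> is the measure \<open>g\<^sub>t(k) dk\<close>; for \<open>t \<le> N - 2\<close> its Lebesgue density on
  \<open>(w, \<infinity>)\<close> is the function \<open>weight_density w \<kappa> t G\<close> with \<open>G = g\<^bsub>t+1\<^esub>(k') dk'\<close>, which may be
  infinite on a null set.
\<close>

definition weight_density ::
  "real \<Rightarrow> (nat \<Rightarrow> nat \<Rightarrow> real \<Rightarrow> real measure) \<Rightarrow> nat \<Rightarrow> real measure \<Rightarrow> real \<Rightarrow> ennreal" where
  "weight_density w \<kappa> t G k =
     (\<integral>\<^sup>+k'\<in>{w..}. ennreal (put_gamma \<kappa> (t + 1) (t + 2) k' (k - w)) \<partial>G)"

function weight ::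
  "nat \<Rightarrow> real \<Rightarrow> (nat \<Rightarrow> nat \<Rightarrow> real \<Rightarrow> real measure) \<Rightarrow> nat \<Rightarrow> real measure" where
  "weight N w \<kappa> t =
     (if t + 1 < N
      then density lborel
             (\<lambda>k. weight_density w \<kappa> t (weight N w \<kappa> (t + 1)) k * indicator {w<..} k)
      else return borel w)"
  by auto
termination
  by (relation "Wellfounded.measure (\<lambda>(N, w, \<kappa>, t). N - t)") auto

declare weight.simps [simp del]

primrec contribution_fund :: "real \<Rightarrow> (nat \<Rightarrow> 'b \<Rightarrow> real) \<Rightarrow> nat \<Rightarrow> 'b \<Rightarrow> real" where
  "contribution_fund w S' 0 y = w"
| "contribution_fund w S' (Suc t) y = contribution_fund w S' t y * (S' (Suc t) y / S' t y) + w"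

end

theory Submission
  imports Defs
begin

text \<open>
  Homogeneity (A2) says that the return \<open>R = S\<^bsub>t+1\<^esub> / S\<^sub>t\<close> is independent of the past, with law
  \<open>\<nu>\<close> say. The derivative of the put in the strike is the distribution function of \<open>\<nu>\<close>, and its
  derivative in the spot is a truncated mean of \<open>\<nu>\<close>; integrating \<open>\<Gamma>\<close> once therefore shows that
  the return of the adjoint process is distributed as \<open>1/R\<close> under the size-biased measure
  \<open>u \<nu>(du)\<close>. Hence \<open>\<integral> (k v - z)\<^sup>+ \<nu>'(dv) = \<integral> (k - z u)\<^sup>+ \<nu>(du)\<close> for the law \<open>\<nu>'\<close> of
  the adjoint return and every real \<open>z\<close>. With
  \<open>z = x r - w\<close> this turns one step of the withdrawal fund (started at \<open>x\<close>, with return \<open>r\<close>) into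
  one step \<open>k \<mapsto> k v + w\<close> of the contribution fund. For \<open>z \<le> 0\<close> the same formula gives \<open>k - z\<close>,
  whose mean over \<open>Y\<^bsub>N-t-1\<^esub>\<close> is the value of the claims of a fund that is already depleted, so that the two
  cases of the backward induction for \<open>V\<^sub>t\<close> need not be distinguished after conditioning.
\<close>

section \<open>Derivatives of put values\<close>

text \<open>Subtracting the supporting line leaves a local minimum at \<open>x\<close>. As (A1)
  already grants differentiability of put values, their derivatives follow from a pointwise
  inequality between payoffs, with no exchange of derivative and integral.\<close>

lemma derivative_eq_subgradient:
  fixes f :: "real \<Rightarrow> real"
  assumes f: "(f has_real_derivative D) (at x)" and d: "0 < d"
    and sub: "\<And>y. \<bar>x - y\<bar> < d \<Longrightarrow> f x + c * (y - x) \<le> f y"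
  shows "D = c"
proof -
  have "((\<lambda>y. f y - c * y) has_real_derivative (D - c)) (at x)"
    by (auto intro!: derivative_eq_intros f)
  moreover have "\<forall>y. \<bar>x - y\<bar> < d \<longrightarrow> f x - c * x \<le> f y - c * y"
    using sub by (fastforce simp: algebra_simps)
  ultimately show ?thesis
    using DERIV_local_min d by fastforce
qed

text \<open>The derivative is a pointwise limit of difference quotients. This serves for the Gamma
  of a put, which (A1) does not make continuous.\<close>

lemma borel_measurable_derivative_on_pos:
  fixes f f' :: "real \<Rightarrow> real"
  assumes [measurable]: "f \<in> borel_measurable borel"
    and f': "\<And>x. 0 < x \<Longrightarrow> (f has_real_derivative f' x) (at x)"
  shows "(\<lambda>x. f' x * indicator {0<..} x) \<in> borel_measurable borel"
proof (rule borel_measurable_LIMSEQ_real)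
  fix x :: real
  let ?g = "\<lambda>n x. real (Suc n) * (f (x + 1 / real (Suc n)) - f x) * indicator {0<..} x"
  show "(\<lambda>n. ?g n x) \<longlonglongrightarrow> f' x * indicator {0<..} x"
  proof (cases "0 < x")
    case True
    have "((\<lambda>h. (f (x + h) - f x) / h) \<longlongrightarrow> f' x) (at 0)"
      using f'[OF True] by (simp add: DERIV_def)
    moreover have "filterlim (\<lambda>n. 1 / real (Suc n)) (at 0) sequentially"
      using LIMSEQ_Suc[OF lim_1_over_n] by (auto simp: filterlim_at)
    ultimately have "(\<lambda>n. (f (x + 1 / real (Suc n)) - f x) / (1 / real (Suc n))) \<longlonglongrightarrow> f' x"
      by (rule filterlim_compose)
    then show ?thesis
      using True by (simp add: mult.commute)
  qed simp
qed measurable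

text \<open>The total mass on the positive half-line is the limit of the tails beyond
  \<open>1 / Suc n\<close>, so positive thresholds suffice. Finiteness is asked of one measure only:
  the other will be a size-biased law whose mass is not known beforehand.\<close>

lemma measure_eqI_greaterThan_pos:
  fixes M N :: "real measure"
  assumes sets: "sets M = sets borel" "sets N = sets borel"
    and null: "emeasure M {..0} = 0" "emeasure N {..0} = 0"
    and fin: "emeasure M {0<..} < \<infinity>"
    and eq: "\<And>x. 0 < x \<Longrightarrow> emeasure M {x<..} = emeasure N {x<..}"
  shows "M = N"
proof -
  have U: "{0<..} = (\<Union>n. {1 / real (Suc n)<..})"
  proof (intro set_eqI iffI)
    fix x :: real assume "x \<in> {0<..}"
    then obtain n where "1 / real (Suc n) < x" using nat_approx_posE[of x] by auto
    then show "x \<in> (\<Union>n. {1 / real (Suc n)<..})" by auto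
  next
    fix x :: real assume "x \<in> (\<Union>n. {1 / real (Suc n)<..})"
    then obtain n where "1 / real (Suc n) < x" by auto
    moreover have "0 < 1 / real (Suc n)" by simp
    ultimately show "x \<in> {0<..}" by (metis greaterThan_iff less_trans)
  qed
  have sup: "(SUP n. emeasure L {1 / real (Suc n)<..}) = emeasure L {0<..}"
    if "sets L = sets borel" for L :: "real measure"
  proof -
    have "incseq (\<lambda>n. {1 / real (Suc n)<..})"
      by (intro monoI greaterThan_subset_iff[THEN iffD2] frac_le) auto
    from SUP_emeasure_incseq[OF _ this, of L] show ?thesis
      unfolding U by (simp add: that image_subset_iff del: of_nat_Suc)
  qed
  have eq0: "emeasure M {0<..} = emeasure N {0<..}"
  proof -
    have "emeasure M {0<..} = (SUP n. emeasure M {1 / real (Suc n)<..})"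
      by (rule sup[OF sets(1), symmetric])
    also have "\<dots> = (SUP n. emeasure N {1 / real (Suc n)<..})"
      by (intro SUP_cong refl eq) simp
    also have "\<dots> = emeasure N {0<..}"
      by (rule sup[OF sets(2)])
    finally show ?thesis .
  qed
  have neg: "emeasure L {x<..} = emeasure L {0<..}"
    if "sets L = sets borel" "emeasure L {..0} = 0" "x \<le> 0" for L :: "real measure" and x
  proof (rule emeasure_eq_AE)
    have "{..0} \<in> null_sets L"
      using that by (intro null_setsI) simp_all
    from AE_not_in[OF this] show "AE y in L. y \<in> {x<..} \<longleftrightarrow> y \<in> {0<..}"
      by eventually_elim (use that(3) in auto)
  qed (use that in auto)
  have all: "emeasure M {x<..} = emeasure N {x<..}" for x
    using eq[of x] eq0 neg[of M x] neg[of N x] sets null by (cases "0 < x") auto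
  have "emeasure M {x<..} \<le> emeasure M {0<..}" for x
  proof (cases "0 < x")
    case True
    then show ?thesis using sets by (intro emeasure_mono) auto
  next
    case False
    then show ?thesis using neg[of M x] sets null by simp
  qed
  then show ?thesis
    using sets fin all by (intro measure_eqI_lessThan) (auto intro: le_less_trans)
qed

lemma put_value_nonneg: "0 \<le> put_value \<kappa> t t' k s"
  unfolding put_value_def by (rule Bochner_Integration.integral_nonneg) simp

section \<open>Put values over a single distribution on the positive half-line\<close>

locale positive_distribution = real_distribution +
  assumes pos: "emeasure M {0<..} = 1"
begin

lemma AE_pos: "AE u in M. 0 < u"
proof -
  have "prob {0<..} = 1"
    using pos by (simp add: measure_def)
  from prob_eq_1[THEN iffD1, OF _ this] show ?thesis
    by simp
qed

lemma integrable_put: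
  assumes "0 \<le> s"
  shows "integrable M (\<lambda>u. max 0 (k - s * u))"
proof (rule integrable_const_bound[where B = "\<bar>k\<bar>"])
  show "AE u in M. norm (max 0 (k - s * u)) \<le> \<bar>k\<bar>"
    using AE_pos
  proof eventually_elim
    case (elim u)
    then have "0 \<le> s * u" using assms by simp
    then show ?case by (auto simp: max_def)
  qed
qed simp

text \<open>The payoff is convex in \<open>k\<close> with subgradient the indicator of
  \<open>u \<le> k\<close>. Integration gives a subgradient of the put; choosing the closed ray
  makes it the distribution function exactly.\<close>

lemma put_strike_derivative:
  assumes "((\<lambda>k. \<integral>u. max 0 (k - u) \<partial>M) has_real_derivative D) (at k)"
  shows "D = cdf M k"
  using assms zero_less_one
proof (rule derivative_eq_subgradient)
  fix y
  have int: "integrable M (\<lambda>u. max 0 (c - u))" for c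
    using integrable_put[of 1 c] by simp
  have "(\<integral>u. max 0 (k - u) \<partial>M) + cdf M k * (y - k) =
      (\<integral>u. max 0 (k - u) + (y - k) * indicator {..k} u \<partial>M)"
  proof (subst Bochner_Integration.integral_add)
    show "integrable M (\<lambda>u. (y - k) * indicator {..k} u :: real)"
      by (intro integrable_mult_right integrable_real_indicator) (auto simp: emeasure_eq_measure)
  qed (use int in \<open>auto simp: cdf_def\<close>)
  also have "\<dots> \<le> (\<integral>u. max 0 (y - u) \<partial>M)"
  proof (rule integral_mono)
    show "integrable M (\<lambda>u. max 0 (k - u) + (y - k) * indicator {..k} u)"
      using int[of k] by (intro Bochner_Integration.integrable_add integrable_mult_right integrable_real_indicator)
        (auto simp: emeasure_eq_measure)
  qed (use int[of y] in \<open>auto simp: indicator_def max_def\<close>)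
  finally show "(\<integral>u. max 0 (k - u) \<partial>M) + cdf M k * (y - k) \<le> (\<integral>u. max 0 (y - u) \<partial>M)" .
qed

text \<open>The mean of \<open>u\<close> truncated to \<open>u < 1 / s\<close>. The strict
  inequality makes it the mass of the open ray beyond \<open>s\<close> under the size-biased law of
  \<open>1 / u\<close>, and its negative is the spot derivative of the put with unit strike.\<close>

definition low_mean :: "real \<Rightarrow> real" where
  "low_mean s = (\<integral>u. u * indicator {..<1} (s * u) \<partial>M)"

lemma borel_measurable_low_mean [measurable]: "low_mean \<in> borel_measurable borel"
  unfolding low_mean_def by measurable

lemma low_mean_bounds:
  assumes "0 < s"
  shows "AE u in M. 0 \<le> u * indicator {..<1} (s * u) \<and> u * indicator {..<1} (s * u) \<le> 1 / s"
  using AE_pos by eventually_elim (use assms in \<open>auto simp: indicator_def field_simps\<close>)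

lemma integrable_low_mean:
  assumes "0 < s"
  shows "integrable M (\<lambda>u. u * indicator {..<1} (s * u))"
  by (rule integrable_const_bound[where B = "1 / s"])
     (use low_mean_bounds[OF assms] in auto)

text \<open>The payoff is convex in \<open>s\<close>, and \<open>- u\<close> on the event
  \<open>s * u < 1\<close> is a subgradient. The radius \<open>s\<close> of the neighbourhood keeps
  the competing spot \<open>y\<close> positive, where the payoffs are integrable.\<close>

lemma put_spot_derivative:
  assumes "((\<lambda>s. \<integral>u. max 0 (1 - s * u) \<partial>M) has_real_derivative D) (at s)" and s: "0 < s"
  shows "D = - low_mean s"
  using assms
proof (rule derivative_eq_subgradient)
  fix y assume "\<bar>s - y\<bar> < s"
  then have y: "0 < y" by auto
  have int: "integrable M (\<lambda>u. max 0 (1 - c * u))" if "0 < c" for c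
    using integrable_put[of c 1] that by simp
  have "(\<integral>u. max 0 (1 - s * u) \<partial>M) + - low_mean s * (y - s) =
      (\<integral>u. max 0 (1 - s * u) + (s - y) * (u * indicator {..<1} (s * u)) \<partial>M)"
    using int[OF s] integrable_low_mean[OF s]
    by (subst Bochner_Integration.integral_add, simp, simp, subst integral_mult_right_zero)
       (simp add: low_mean_def algebra_simps)
  also have "\<dots> \<le> (\<integral>u. max 0 (1 - y * u) \<partial>M)"
  proof (rule integral_mono)
    show "integrable M (\<lambda>u. max 0 (1 - s * u) + (s - y) * (u * indicator {..<1} (s * u)))"
      using int[OF s] integrable_low_mean[OF s] by simp
  qed (use int[OF y] in \<open>auto simp: indicator_def max_def algebra_simps\<close>)
  finally show "(\<integral>u. max 0 (1 - s * u) \<partial>M) + - low_mean s * (y - s) \<le> (\<integral>u. max 0 (1 - y * u) \<partial>M)" .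
qed

lemma low_mean_antimono:
  assumes "0 < s" "s \<le> t"
  shows "low_mean t \<le> low_mean s"
  unfolding low_mean_def
proof (rule integral_mono_AE)
  show "AE u in M. u * indicator {..<1} (t * u) \<le> u * indicator {..<1} (s * u)"
    using AE_pos
  proof eventually_elim
    case (elim u)
    then have "s * u \<le> t * u" using assms by simp
    then have "t * u < 1 \<Longrightarrow> s * u < 1" by (rule le_less_trans)
    then show ?case using elim by (auto simp: indicator_def)
  qed
qed (use assms integrable_low_mean in auto)

text \<open>On the event \<open>s * u < 1\<close> the integrand is at most \<open>1 / s\<close>.
  This is the boundary value at infinity when Gamma is integrated over a ray.\<close>

lemma low_mean_at_top: "(low_mean \<longlongrightarrow> 0) at_top"
proof (rule tendsto_sandwich)
  show "\<forall>\<^sub>F s in at_top. 0 \<le> low_mean s"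
    using eventually_gt_at_top[of 0] unfolding low_mean_def
    by eventually_elim (use low_mean_bounds in \<open>auto intro!: integral_nonneg_AE elim!: eventually_mono\<close>)
  show "\<forall>\<^sub>F s in at_top. low_mean s \<le> 1 / s"
    using eventually_gt_at_top[of 0]
  proof eventually_elim
    case (elim s)
    then show ?case
      using low_mean_bounds[OF elim] integrable_low_mean[OF elim] prob_space unfolding low_mean_def
      by (intro integral_le_const) auto
  qed
  show "((\<lambda>s. 1 / s) \<longlongrightarrow> (0::real)) at_top"
    by (intro tendsto_divide_0[OF tendsto_const] filterlim_at_top_imp_at_infinity filterlim_ident)
qed simp

text \<open>A change of numeraire: the law of \<open>1 / u\<close> under the measure with density
  \<open>u\<close>, the function \<open>ennreal\<close> being that density. Its total mass is the
  mean of \<open>M\<close>, which need not be 1 here.\<close>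

definition inverse_size_biased :: "real measure" where
  "inverse_size_biased = distr (density M ennreal) borel inverse"

lemma sets_inverse_size_biased [simp, measurable_cong]: "sets inverse_size_biased = sets borel"
  by (simp add: inverse_size_biased_def)

lemma nn_integral_inverse_size_biased:
  assumes [measurable]: "f \<in> borel_measurable borel"
  shows "(\<integral>\<^sup>+v. f v \<partial>inverse_size_biased) = (\<integral>\<^sup>+u. ennreal u * f (inverse u) \<partial>M)"
  by (simp add: inverse_size_biased_def nn_integral_distr nn_integral_density)

lemma inverse_size_biased_null: "emeasure inverse_size_biased {..0} = 0"
proof -
  have "emeasure inverse_size_biased {..0} = (\<integral>\<^sup>+v. indicator {..0} v \<partial>inverse_size_biased)"
    by simp
  also have "\<dots> = (\<integral>\<^sup>+u. ennreal u * indicator {..0} (inverse u) \<partial>M)"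
    by (subst nn_integral_inverse_size_biased) auto
  also have "\<dots> = (\<integral>\<^sup>+u. 0 \<partial>M)"
    using AE_pos by (intro nn_integral_cong_AE) (auto elim!: eventually_mono)
  finally show ?thesis by simp
qed

lemma inverse_size_biased_greaterThan:
  assumes "0 < s"
  shows "emeasure inverse_size_biased {s<..} = ennreal (low_mean s)"
proof -
  have "emeasure inverse_size_biased {s<..} = (\<integral>\<^sup>+v. indicator {s<..} v \<partial>inverse_size_biased)"
    by simp
  also have "\<dots> = (\<integral>\<^sup>+u. ennreal u * indicator {s<..} (inverse u) \<partial>M)"
    by (subst nn_integral_inverse_size_biased) auto
  also have "\<dots> = (\<integral>\<^sup>+u. ennreal (u * indicator {..<1} (s * u)) \<partial>M)"
    using AE_pos
    by (intro nn_integral_cong_AE) (auto elim!: eventually_mono simp: indicator_def field_simps)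
  also have "\<dots> = ennreal (low_mean s)"
    unfolding low_mean_def using low_mean_bounds[OF assms] integrable_low_mean[OF assms]
    by (intro nn_integral_eq_integral) auto
  finally show ?thesis .
qed

text \<open>The spot derivative of the put is \<open>- low_mean\<close>, so integrating Gamma from
  \<open>x\<close> to infinity gives \<open>low_mean x\<close>, the tail of
  \<open>inverse_size_biased\<close>. That \<open>G\<close> is a probability provides the finite
  mass needed to compare measures by tails.\<close>

lemma spot_gamma_eq_inverse_size_biased:
  fixes q :: "real \<Rightarrow> real"
  defines "G \<equiv> density lborel (\<lambda>y. ennreal (deriv (deriv q) y) * indicator {0<..} y)"
  assumes q: "\<And>s. 0 < s \<Longrightarrow> q s = (\<integral>u. max 0 (1 - s * u) \<partial>M)"
    and diff: "twice_differentiable_on_pos q"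
    and prob: "prob_space G"
  shows "G = inverse_size_biased"
    and "(\<lambda>y. deriv (deriv q) y * indicator {0<..} y) \<in> borel_measurable borel"
proof -
  have dq: "deriv q s = - low_mean s" if "0 < s" for s
  proof (rule put_spot_derivative[OF _ that])
    have "(q has_real_derivative deriv q s) (at s)"
      using diff that unfolding twice_differentiable_on_pos_def DERIV_deriv_iff_field_differentiable by blast
    then show "((\<lambda>s. \<integral>u. max 0 (1 - s * u) \<partial>M) has_real_derivative deriv q s) (at s)"
      by (rule has_field_derivative_transform_within_open[where S = "{0<..}"]) (use that q in auto)
  qed
  have ddq: "((\<lambda>s. - low_mean s) has_real_derivative deriv (deriv q) s) (at s)" if "0 < s" for s
  proof -
    have "(deriv q has_real_derivative deriv (deriv q) s) (at s)"
      using diff that unfolding twice_differentiable_on_pos_def DERIV_deriv_iff_field_differentiable by blast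
    then show ?thesis
      by (rule has_field_derivative_transform_within_open[where S = "{0<..}"]) (use that dq in auto)
  qed
  show meas [measurable]: "(\<lambda>y. deriv (deriv q) y * indicator {0<..} y) \<in> borel_measurable borel"
    by (rule borel_measurable_derivative_on_pos[where f = "\<lambda>s. - low_mean s"]) (auto intro: ddq)
  \<comment> \<open>A negative derivative of \<open>- low_mean\<close> would make
    \<open>low_mean\<close> increase just to the right of \<open>y\<close>, against its
    monotonicity.\<close>
  have nonneg: "0 \<le> deriv (deriv q) y" if y: "0 < y" for y
  proof (rule ccontr)
    assume "\<not> 0 \<le> deriv (deriv q) y"
    then obtain d where "0 < d" and d: "\<forall>h>0. h < d \<longrightarrow> - low_mean (y + h) < - low_mean y"
      using DERIV_neg_dec_right[OF ddq[OF y]] by force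
    then have "low_mean y < low_mean (y + d / 2)"
      using d[rule_format, of "d / 2"] by simp
    then show False
      using low_mean_antimono[of y "y + d / 2"] y \<open>0 < d\<close> by simp
  qed
  have G: "G = density lborel (\<lambda>y. ennreal (deriv (deriv q) y * indicator {0<..} y))"
    unfolding G_def by (intro arg_cong[where f = "density lborel"] ext) (auto simp: indicator_def)
  show "G = inverse_size_biased"
  proof (rule measure_eqI_greaterThan_pos)
    show "emeasure G {..0} = 0"
    proof -
      have "emeasure G {..0} =
          (\<integral>\<^sup>+y. ennreal (deriv (deriv q) y * indicator {0<..} y) * indicator {..0} y \<partial>lborel)"
        unfolding G by (simp add: emeasure_density)
      also have "\<dots> = (\<integral>\<^sup>+y. 0 \<partial>(lborel :: real measure))"
        by (intro nn_integral_cong) (simp split: split_indicator)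
      finally show ?thesis by simp
    qed
    show "emeasure G {0<..} < \<infinity>"
      using prob_space.emeasure_le_1[OF prob, of "{0<..}"] by (auto simp: le_less_trans)
    fix x :: real assume x: "0 < x"
    \<comment> \<open>\<open>G\<close> has a Lebesgue density, so the endpoint carries no mass; the
      fundamental theorem below is applied on a closed ray.\<close>
    have "emeasure G {x<..} = emeasure G {x..}"
      unfolding G by (rule emeasure_eq_AE) (use AE_lborel_singleton[of x] in \<open>auto simp: AE_density elim!: eventually_mono\<close>)
    also have "\<dots> = (\<integral>\<^sup>+y. ennreal (deriv (deriv q) y * indicator {0<..} y) * indicator {x..} y \<partial>lborel)"
      unfolding G by (simp add: emeasure_density)
    \<comment> \<open>The antiderivative is \<open>- low_mean\<close>, with limit \<open>- 0\<close>
      at infinity.\<close>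
    also have "\<dots> = ennreal (- 0 - (- low_mean x))"
      by (rule nn_integral_FTC_atLeast)
         (use x ddq nonneg meas tendsto_minus[OF low_mean_at_top] in auto)
    also have "\<dots> = emeasure inverse_size_biased {x<..}"
      by (simp add: inverse_size_biased_greaterThan[OF x])
    finally show "emeasure G {x<..} = emeasure inverse_size_biased {x<..}" .
  qed (auto simp: G inverse_size_biased_null)
qed

end

section \<open>Independent returns\<close>

lemma positive_distribution_distr_mult:
  assumes "positive_distribution \<nu>" and s: "0 < s"
  shows "positive_distribution (distr \<nu> borel ((*) s))"
proof -
  interpret positive_distribution \<nu> by fact
  have "(*) s -` {0<..} = {0<..}"
    using s by (auto simp: zero_less_mult_iff)
  then show ?thesis
    using pos by (intro positive_distribution.intro real_distribution.intro real_distribution_axioms.intro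
        positive_distribution_axioms.intro prob_space_distr) (auto simp: emeasure_distr)
qed

lemma (in positive_markov_process) positive_distribution_kernel:
  assumes "t < t'" "t' \<le> N" "0 < s"
  shows "positive_distribution (\<kappa> t t' s)"
proof -
  have "\<kappa> t t' s \<in> space (prob_algebra borel)"
    using measurable_space[OF kernel[OF assms(1,2)], of s] assms(3) by (simp add: space_restrict_space)
  then show ?thesis
    using kernel_positive[OF assms] unfolding space_prob_algebra
    by (intro positive_distribution.intro real_distribution.intro real_distribution_axioms.intro
        positive_distribution_axioms.intro) (auto dest: sets_eq_imp_space_eq)
qed

locale homogeneous_model =
  fixes M :: "'a measure" and F :: "nat \<Rightarrow> 'a measure" and N :: nat
    and S :: "nat \<Rightarrow> 'a \<Rightarrow> real" and \<kappa> :: "nat \<Rightarrow> nat \<Rightarrow> real \<Rightarrow> real measure"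
  assumes A1: "A1 M F N S \<kappa>" and A2: "A2 N \<kappa>"

sublocale homogeneous_model \<subseteq> positive_markov_process M F N S \<kappa>
  using A1 by (simp add: A1_def)

context homogeneous_model
begin

text \<open>At spot 1 the next price is itself the return.\<close>

definition return_law :: "nat \<Rightarrow> real measure" where
  "return_law t = \<kappa> t (Suc t) 1"

lemma positive_distribution_return_law: "t < N \<Longrightarrow> positive_distribution (return_law t)"
  unfolding return_law_def by (rule positive_distribution_kernel) auto

lemma put_value_homogeneous:
  assumes "t < N" "0 < a" "0 < k" "0 < s"
  shows "put_value \<kappa> t (Suc t) (a * k) (a * s) = a * put_value \<kappa> t (Suc t) k s"
  using A2 assms unfolding A2_def by simp

lemma put_value_strike_derivative:
  assumes "t < N" "0 < k" "0 < s"
  shows "((\<lambda>k. put_value \<kappa> t (Suc t) k s) has_real_derivative cdf (\<kappa> t (Suc t) s) k) (at k)"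
proof -
  interpret K: positive_distribution "\<kappa> t (Suc t) s"
    using assms by (intro positive_distribution_kernel) auto
  obtain D where D: "((\<lambda>k. put_value \<kappa> t (Suc t) k s) has_real_derivative D) (at k)"
    using A1 assms unfolding A1_def twice_differentiable_on_pos_def field_differentiable_def
    by (metis Suc_leI lessI)
  then have "D = cdf (\<kappa> t (Suc t) s) k"
    using K.put_strike_derivative[of D k] by (simp add: put_value_def)
  with D show ?thesis by simp
qed

text \<open>This is where (A2) becomes independence of returns. Differentiating the homogeneity
  relation in the strike identifies the distribution functions at \<open>k > 0\<close>; for
  \<open>k \<le> 0\<close> both vanish by positivity.\<close>

lemma kernel_scaling:
  assumes t: "t < N" and s: "0 < s"
  shows "\<kappa> t (Suc t) s = distr (return_law t) borel ((*) s)"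
proof -
  interpret \<nu>: positive_distribution "return_law t"
    by (rule positive_distribution_return_law[OF t])
  interpret s: positive_distribution "\<kappa> t (Suc t) s"
    using assms by (intro positive_distribution_kernel) auto
  interpret d: positive_distribution "distr (return_law t) borel ((*) s)"
    by (rule positive_distribution_distr_mult) (use s \<nu>.positive_distribution_axioms in auto)
  have null: "cdf L k = 0" if "positive_distribution L" "k \<le> 0" for L k
  proof -
    interpret L: positive_distribution L by fact
    have "AE x in L. x \<notin> {..k}"
      using L.AE_pos by eventually_elim (use that(2) in auto)
    then show ?thesis
      by (simp add: cdf_def L.prob_eq_0)
  qed
  have "cdf (\<kappa> t (Suc t) s) k = cdf (distr (return_law t) borel ((*) s)) k" for k
  proof (cases "0 < k")
    case True
    have "((\<lambda>k. s * put_value \<kappa> t (Suc t) (k / s) 1) has_real_derivative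
        s * (cdf (return_law t) (k / s) * (1 / s))) (at k)"
      using put_value_strike_derivative[of t "k / s" 1] t s True unfolding return_law_def
      by (intro DERIV_cmult DERIV_chain2[where f = "\<lambda>k. put_value \<kappa> t (Suc t) k 1"] DERIV_cdivide DERIV_ident)
        auto
    then have "((\<lambda>k. put_value \<kappa> t (Suc t) k s) has_real_derivative
        s * (cdf (return_law t) (k / s) * (1 / s))) (at k)"
      by (rule has_field_derivative_transform_within_open[where S = "{0<..}"])
        (use True t s put_value_homogeneous[of t s "_ / s" 1] in auto)
    then have "cdf (\<kappa> t (Suc t) s) k = s * (cdf (return_law t) (k / s) * (1 / s))"
      using put_value_strike_derivative[OF t True s] DERIV_unique by blast
    moreover have "(*) s -` {..k} = {..k / s}"
      using s by (auto simp: field_simps)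
    ultimately show ?thesis
      using s by (simp add: cdf_def measure_distr)
  next
    case False
    then show ?thesis
      using null s.positive_distribution_axioms d.positive_distribution_axioms by simp
  qed
  then show ?thesis
    using s.real_distribution_axioms d.real_distribution_axioms by (intro cdf_unique) auto
qed

lemma put_value_eq:
  assumes "t < N" "0 < s"
  shows "put_value \<kappa> t (Suc t) k s = (\<integral>u. max 0 (k - s * u) \<partial>return_law t)"
proof -
  interpret K: positive_distribution "return_law t"
    by (rule positive_distribution_return_law[OF assms(1)])
  show ?thesis
    unfolding put_value_def kernel_scaling[OF assms] by (simp add: integral_distr)
qed

lemma put_value_spot_twice_differentiable:
  assumes "t < N" "0 < k"
  shows "twice_differentiable_on_pos (\<lambda>s. put_value \<kappa> t (Suc t) k s)"
  using A1 assms unfolding A1_def by auto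

text \<open>The put is \<open>k\<close> times the unit-strike put at spot \<open>s / k\<close>; each
  differentiation in \<open>s\<close> lowers the degree of homogeneity by one, so Gamma has degree
  -1.\<close>

lemma put_gamma_homogeneous:
  assumes t: "t < N" and k: "0 < k" and s: "0 < s"
  shows "put_gamma \<kappa> t (Suc t) k s = put_gamma \<kappa> t (Suc t) 1 (s / k) / k"
proof -
  let ?q = "\<lambda>s. put_value \<kappa> t (Suc t) 1 s"
  have q: "(?q has_real_derivative deriv ?q y) (at y)"
      "(deriv ?q has_real_derivative deriv (deriv ?q) y) (at y)" if "0 < y" for y
    using put_value_spot_twice_differentiable[OF t, of 1] that
    unfolding twice_differentiable_on_pos_def DERIV_deriv_iff_field_differentiable by auto
  have 1: "deriv (\<lambda>s. put_value \<kappa> t (Suc t) k s) y = deriv ?q (y / k)" if y: "0 < y" for y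
  proof (rule DERIV_imp_deriv)
    have "((\<lambda>y. k * ?q (y / k)) has_real_derivative k * (deriv ?q (y / k) * (1 / k))) (at y)"
      using y k by (intro DERIV_cmult DERIV_chain2[where f = ?q] q DERIV_cdivide DERIV_ident) auto
    then have "((\<lambda>y. k * ?q (y / k)) has_real_derivative deriv ?q (y / k)) (at y)"
      using k by simp
    then show "((\<lambda>s. put_value \<kappa> t (Suc t) k s) has_real_derivative deriv ?q (y / k)) (at y)"
      by (rule has_field_derivative_transform_within_open[where S = "{0<..}"])
        (use y t k put_value_homogeneous[of t k 1 "_ / k"] in auto)
  qed
  have "((\<lambda>y. deriv ?q (y / k)) has_real_derivative deriv (deriv ?q) (s / k) * (1 / k)) (at s)"
    using s k by (intro DERIV_chain2[where f = "deriv ?q"] q DERIV_cdivide DERIV_ident) auto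
  then have "(deriv (\<lambda>s. put_value \<kappa> t (Suc t) k s) has_real_derivative
      deriv (deriv ?q) (s / k) * (1 / k)) (at s)"
    by (rule has_field_derivative_transform_within_open[where S = "{0<..}"]) (use s 1 in auto)
  then show ?thesis
    unfolding put_gamma_def by (simp add: DERIV_imp_deriv)
qed

end

section \<open>Independence of the next return from the past\<close>

context positive_markov_process
begin

text \<open>The Markov property determines the joint law of the past and the next price on
  rectangles, hence everywhere; dividing by the positive \<open>S t\<close> then yields the joint
  law of the past and the return. No asset-specific assumption enters, so the lemma serves both the
  asset and the adjoint process.\<close>

lemma nn_integral_independent_return:
  assumes t: "t < N"
    and "prob_space \<nu>" and [simp, measurable_cong]: "sets \<nu> = sets borel"
    and scaling: "\<And>s. 0 < s \<Longrightarrow> \<kappa> t (Suc t) s = distr \<nu> borel ((*) s)"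
    and h [measurable]: "h \<in> borel_measurable (F t \<Otimes>\<^sub>M borel)"
  shows "(\<integral>\<^sup>+x. h (x, S (Suc t) x / S t x) \<partial>M) = (\<integral>\<^sup>+x. \<integral>\<^sup>+u. h (x, u) \<partial>\<nu> \<partial>M)"
proof -
  have sub: "subalgebra M (F t)" "subalgebra M (F (Suc t))"
    using subalgebra_F t by auto
  interpret Ft: finite_measure_subalgebra M "F t"
    by unfold_locales (use sub in auto)
  interpret \<nu>: prob_space \<nu> by fact
  \<comment> \<open>Restricting \<open>M\<close> to \<open>F t\<close> gives the product with
    \<open>\<nu>\<close> exactly the sigma-algebra of the pairs (past, return).\<close>
  let ?R = "restr_to_subalg M (F t)"
  have [measurable_cong]: "sets ?R = sets (F t)"
    by (rule sets_restr_to_subalg[OF sub(1)])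
  have spF [simp]: "space (F t) = space M"
    using sub(1) by (simp add: subalgebra_def)
  have [measurable]: "id \<in> M \<rightarrow>\<^sub>M F t" "(\<lambda>x. x) \<in> M \<rightarrow>\<^sub>M F t"
    using sub(1) by (auto intro!: measurableI simp: subalgebra_def)
  have SF [measurable]: "S t \<in> borel_measurable (F t)"
    using adapted t by auto
  have SM [measurable]: "S t \<in> borel_measurable M" "S (Suc t) \<in> borel_measurable M"
    using measurable_from_subalg[OF sub(1) SF] measurable_from_subalg[OF sub(2) adapted[of "Suc t"]] t
    by auto
  define J where "J = distr M (F t \<Otimes>\<^sub>M borel) (\<lambda>x. (x, S (Suc t) x))"
  define J' where "J' = distr (?R \<Otimes>\<^sub>M \<nu>) (F t \<Otimes>\<^sub>M borel) (\<lambda>(x, u). (x, S t x * u))"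
  have rect: "emeasure J (A \<times> B) = emeasure J' (A \<times> B)"
    if A [measurable]: "A \<in> sets (F t)" and B [measurable]: "B \<in> sets borel" for A B
  proof -
    have AM [measurable]: "A \<in> sets M"
      using sub(1) A by (auto simp: subalgebra_def)
    have K: "measure (\<kappa> t (Suc t) (S t x)) B = (\<integral>u. indicator B (S t x * u) \<partial>\<nu>)"
      if "x \<in> space M" for x
    proof -
      have "measure (\<kappa> t (Suc t) (S t x)) B = measure \<nu> ((*) (S t x) -` B \<inter> space \<nu>)"
        using scaling[OF positive[of t x]] t that by (simp add: measure_distr)
      also have "\<dots> = (\<integral>u. indicator ((*) (S t x) -` B \<inter> space \<nu>) u \<partial>\<nu>)"
        by simp
      also have "\<dots> = (\<integral>u. indicator B (S t x * u) \<partial>\<nu>)"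
        by (intro Bochner_Integration.integral_cong) (auto simp: indicator_def)
      finally show ?thesis .
    qed
    have int: "integrable M (\<lambda>x. indicator A x * (\<integral>u. indicator B (S t x * u) \<partial>\<nu>) :: real)"
    proof (rule integrable_const_bound[where B = 1])
      have "0 \<le> (\<integral>u. indicator B (S t x * u) \<partial>\<nu> :: real)" for x
        by (rule Bochner_Integration.integral_nonneg) auto
      moreover have "(\<integral>u. indicator B (S t x * u) \<partial>\<nu>) \<le> (1 :: real)" for x
        by (intro \<nu>.integral_le_const \<nu>.integrable_const_bound[where B = 1]) auto
      ultimately show "AE x in M. norm (indicator A x * (\<integral>u. indicator B (S t x * u) \<partial>\<nu>) :: real) \<le> 1"
        by (intro AE_I2) (simp add: abs_mult mult_le_one)
    qed simp
    have "emeasure J (A \<times> B) = emeasure M (A \<inter> S (Suc t) -` B \<inter> space M)"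
      unfolding J_def
      by (subst emeasure_distr) (use sets.sets_into_space[OF AM] in \<open>auto intro!: arg_cong[where f = "emeasure M"]\<close>)
    also have "\<dots> = ennreal (\<integral>x. indicator A x * indicator B (S (Suc t) x) \<partial>M)"
    proof -
      have "(\<integral>x. indicator A x * indicator B (S (Suc t) x) \<partial>M) =
          (\<integral>x. indicator (A \<inter> S (Suc t) -` B \<inter> space M) x \<partial>M :: real)"
        by (intro Bochner_Integration.integral_cong) (auto split: split_indicator)
      also have "\<dots> = measure M (A \<inter> S (Suc t) -` B \<inter> space M)"
        by (simp add: Int_absorb2)
      finally show ?thesis
        by (simp add: emeasure_eq_measure)
    qed
    \<comment> \<open>As \<open>A\<close> belongs to \<open>F t\<close>, the indicator of the next
      price may be replaced by its conditional expectation, which the Markov property then expresses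
      through the kernel.\<close>
    also have "(\<integral>x. indicator A x * indicator B (S (Suc t) x) \<partial>M) =
        (\<integral>x\<in>A. real_cond_exp M (F t) (\<lambda>y. indicator B (S (Suc t) y)) x \<partial>M)"
    proof -
      have "integrable M (\<lambda>y. indicator B (S (Suc t) y) :: real)"
        by (rule integrable_const_bound[where B = 1]) auto
      from Ft.real_cond_exp_intA[OF this A] show ?thesis
        by (simp add: set_lebesgue_integral_def)
    qed
    also have "\<dots> = (\<integral>x. indicator A x * (\<integral>u. indicator B (S t x * u) \<partial>\<nu>) \<partial>M)"
      unfolding set_lebesgue_integral_def
    proof (rule integral_cong_AE)
      show "AE x in M. indicator A x *\<^sub>R real_cond_exp M (F t) (\<lambda>y. indicator B (S (Suc t) y)) x =
          indicator A x * (\<integral>u. indicator B (S t x * u) \<partial>\<nu>)"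
        using markov[of t "Suc t" B] t B AE_space by (auto elim!: eventually_elim2 simp: K)
    qed simp_all
    also have "ennreal \<dots> = (\<integral>\<^sup>+x. ennreal (indicator A x * (\<integral>u. indicator B (S t x * u) \<partial>\<nu>)) \<partial>M)"
      by (rule nn_integral_eq_integral[symmetric, OF int]) (auto intro!: AE_I2 mult_nonneg_nonneg Bochner_Integration.integral_nonneg)
    also have "\<dots> = (\<integral>\<^sup>+x. \<integral>\<^sup>+u. indicator (A \<times> B) (x, S t x * u) \<partial>\<nu> \<partial>M)"
    proof (rule nn_integral_cong)
      fix x
      have "ennreal (\<integral>u. indicator B (S t x * u) \<partial>\<nu>) = (\<integral>\<^sup>+u. indicator B (S t x * u) \<partial>\<nu>)"
        by (subst nn_integral_eq_integral[symmetric])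
           (auto intro!: \<nu>.integrable_const_bound[where B = 1] simp: ennreal_indicator)
      then show "ennreal (indicator A x * (\<integral>u. indicator B (S t x * u) \<partial>\<nu>)) =
          (\<integral>\<^sup>+u. indicator (A \<times> B) (x, S t x * u) \<partial>\<nu>)"
        by (auto simp: indicator_times split: split_indicator)
    qed
    also have "\<dots> = (\<integral>\<^sup>+x. \<integral>\<^sup>+u. indicator (A \<times> B) (x, S t x * u) \<partial>\<nu> \<partial>?R)"
      by (rule nn_integral_subalgebra2[OF sub(1), symmetric]) measurable
    also have "\<dots> = (\<integral>\<^sup>+z. indicator (A \<times> B) (case z of (x, u) \<Rightarrow> (x, S t x * u)) \<partial>(?R \<Otimes>\<^sub>M \<nu>))"
      by (subst \<nu>.nn_integral_fst[symmetric]) auto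
    also have "\<dots> = (\<integral>\<^sup>+z. indicator (A \<times> B) z \<partial>J')"
      unfolding J'_def by (subst nn_integral_distr) auto
    also have "\<dots> = emeasure J' (A \<times> B)"
      by (rule nn_integral_indicator) (auto simp: J'_def)
    finally show ?thesis .
  qed
  have "J = J'"
  proof (rule measure_eqI_generator_eq[OF Int_stable_pair_measure_generator[of "F t" borel]])
    show "{a \<times> b |a b. a \<in> sets (F t) \<and> b \<in> sets borel} \<subseteq> Pow (space (F t) \<times> UNIV)"
      using sets.sets_into_space[of _ "F t"] by auto
    show "sets J = sigma_sets (space (F t) \<times> UNIV) {a \<times> b |a b. a \<in> sets (F t) \<and> b \<in> sets borel}"
      "sets J' = sigma_sets (space (F t) \<times> UNIV) {a \<times> b |a b. a \<in> sets (F t) \<and> b \<in> sets borel}"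
      by (simp_all add: J_def J'_def sets_pair_measure)
    show "range (\<lambda>i::nat. space (F t) \<times> UNIV) \<subseteq> {a \<times> b |a b. a \<in> sets (F t) \<and> b \<in> sets borel}"
    proof (intro image_subsetI CollectI exI conjI)
      show "space (F t) \<times> UNIV = space (F t) \<times> UNIV" ..
    qed (simp_all add: sets.top del: spF)
    have "prob_space J"
      unfolding J_def by (intro prob_space_distr) measurable
    then show "emeasure J (space (F t) \<times> UNIV) \<noteq> \<infinity>"
      using prob_space.emeasure_le_1[of J "space (F t) \<times> UNIV"] by (auto simp: top_unique)
  qed (use rect in auto)
  have "(\<integral>\<^sup>+x. h (x, S (Suc t) x / S t x) \<partial>M) = (\<integral>\<^sup>+z. h (case z of (x, y) \<Rightarrow> (x, y / S t x)) \<partial>J)"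
    unfolding J_def by (subst nn_integral_distr) auto
  also have "\<dots> = (\<integral>\<^sup>+z. h (case z of (x, u) \<Rightarrow> (x, S t x * u / S t x)) \<partial>(?R \<Otimes>\<^sub>M \<nu>))"
    unfolding \<open>J = J'\<close> J'_def by (subst nn_integral_distr) (auto intro!: nn_integral_cong)
  also have "\<dots> = (\<integral>\<^sup>+x. \<integral>\<^sup>+u. h (x, S t x * u / S t x) \<partial>\<nu> \<partial>?R)"
    by (subst \<nu>.nn_integral_fst[symmetric]) auto
  also have "\<dots> = (\<integral>\<^sup>+x. \<integral>\<^sup>+u. h (x, S t x * u / S t x) \<partial>\<nu> \<partial>M)"
    by (rule nn_integral_subalgebra2[OF sub(1)]) measurable
  also have "\<dots> = (\<integral>\<^sup>+x. \<integral>\<^sup>+u. h (x, u) \<partial>\<nu> \<partial>M)"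
  proof (rule nn_integral_cong)
    fix x assume "x \<in> space M"
    then have "0 < S t x" using positive t by auto
    then show "(\<integral>\<^sup>+u. h (x, S t x * u / S t x) \<partial>\<nu>) = (\<integral>\<^sup>+u. h (x, u) \<partial>\<nu>)"
      by simp
  qed
  finally show ?thesis .
qed

end

section \<open>The adjoint process and the contribution fund\<close>

context positive_markov_process
begin

lemma measurable_earlier:
  assumes "f \<in> measurable (F t) L" "t \<le> t'" "t' \<le> N"
  shows "f \<in> measurable (F t') L"
  using measurable_from_subalg[OF F_mono[OF assms(2,3)] assms(1)] .

lemma measurable_filtration:
  assumes "f \<in> measurable (F t) L" "t \<le> N"
  shows "f \<in> measurable M L"
  using measurable_from_subalg[OF subalgebra_F[OF assms(2)] assms(1)] .

end

section \<open>Returns of the reverse Gamma-adjoint process\<close>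

locale reverse_adjoint_pair = homogeneous_model +
  fixes M' :: "'b measure" and S' :: "nat \<Rightarrow> 'b \<Rightarrow> real"
  assumes adjoint: "reverse_gamma_adjoint M' N S' \<kappa>"

sublocale reverse_adjoint_pair \<subseteq>
  adj: positive_markov_process M' "natural_filtration M' S'" N S' "adjoint_kernel N \<kappa>"
  using adjoint by (simp add: reverse_gamma_adjoint_def)

context reverse_adjoint_pair
begin

text \<open>The index is the time of the asset: this is the adjoint transition density from spot 1
  over the step from \<open>N - Suc t\<close> to \<open>N - t\<close>.\<close>

definition adjoint_return_law :: "nat \<Rightarrow> real measure" where
  "adjoint_return_law t =
     density lborel (\<lambda>y. ennreal (put_gamma \<kappa> t (Suc t) 1 y) * indicator {0<..} y)"

lemma sets_adjoint_return_law [simp, measurable_cong]: "sets (adjoint_return_law t) = sets borel"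
  by (simp add: adjoint_return_law_def)

lemma positive_distribution_adjoint_return_law:
  assumes "t < N"
  shows "positive_distribution (adjoint_return_law t)"
proof -
  have "N - (N - Suc t) = Suc t" "N - (N - t) = t"
    using assms by auto
  then have "adjoint_return_law t = adjoint_kernel N \<kappa> (N - Suc t) (N - t) 1"
    by (simp add: adjoint_return_law_def adjoint_kernel_def)
  then show ?thesis
    using adj.positive_distribution_kernel[of "N - Suc t" "N - t" 1] assms by simp
qed

text \<open>The adjoint kernel at spot 1 is a probability by adjointness, which is the condition
  under which the unit-strike Gamma was identified with the size-biased law.\<close>

lemma
  assumes t: "t < N"
  shows adjoint_return_law_eq:
      "adjoint_return_law t = positive_distribution.inverse_size_biased (return_law t)"
    and borel_measurable_spot_gamma:
      "(\<lambda>y. put_gamma \<kappa> t (Suc t) 1 y * indicator {0<..} y) \<in> borel_measurable borel"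
proof -
  interpret \<nu>: positive_distribution "return_law t"
    by (rule positive_distribution_return_law[OF t])
  interpret \<mu>: positive_distribution "adjoint_return_law t"
    by (rule positive_distribution_adjoint_return_law[OF t])
  have "prob_space (density lborel (\<lambda>y. ennreal (deriv (deriv (put_value \<kappa> t (Suc t) 1)) y) * indicator {0<..} y))"
    using \<mu>.prob_space_axioms by (simp add: adjoint_return_law_def put_gamma_def)
  note * = \<nu>.spot_gamma_eq_inverse_size_biased[OF put_value_eq[OF t, of _ 1]
      put_value_spot_twice_differentiable[OF t, of 1] this]
  show "adjoint_return_law t = positive_distribution.inverse_size_biased (return_law t)"
    using *(1) by (simp add: adjoint_return_law_def put_gamma_def)
  show "(\<lambda>y. put_gamma \<kappa> t (Suc t) 1 y * indicator {0<..} y) \<in> borel_measurable borel"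
    using *(2) by (simp add: put_gamma_def)
qed

text \<open>With \<open>v = 1 / u\<close> and weight \<open>u\<close>, the payoff becomes
  \<open>u * (k / u - z) = k - z * u\<close>. Here \<open>ennreal\<close> takes positive parts and
  \<open>z\<close> may be any real, so depleted funds are covered as well.\<close>

lemma put_call_duality:
  assumes t: "t < N"
  shows "(\<integral>\<^sup>+v. ennreal (k * v - z) \<partial>adjoint_return_law t) =
    (\<integral>\<^sup>+u. ennreal (k - z * u) \<partial>return_law t)"
proof -
  interpret \<nu>: positive_distribution "return_law t"
    by (rule positive_distribution_return_law[OF t])
  have "(\<integral>\<^sup>+v. ennreal (k * v - z) \<partial>adjoint_return_law t) =
      (\<integral>\<^sup>+u. ennreal u * ennreal (k * inverse u - z) \<partial>return_law t)"
    unfolding adjoint_return_law_eq[OF t] by (rule \<nu>.nn_integral_inverse_size_biased) simp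
  also have "\<dots> = (\<integral>\<^sup>+u. ennreal (k - z * u) \<partial>return_law t)"
  proof (rule nn_integral_cong_AE)
    show "AE u in return_law t. ennreal u * ennreal (k * inverse u - z) = ennreal (k - z * u)"
      using \<nu>.AE_pos
    proof eventually_elim
      case (elim u)
      then have "u * (k * inverse u - z) = k - z * u"
        by (simp add: field_simps)
      then show ?case
        using elim by (subst ennreal_mult'[symmetric]) auto
    qed
  qed
  finally show ?thesis .
qed

text \<open>Substituting \<open>x = k * v + c\<close>, the Jacobian \<open>k\<close> cancels against
  the degree -1 of Gamma. Taking \<open>c = 0\<close> gives the adjoint kernel, and
  \<open>c = w\<close> one step of the weight recursion.\<close>

lemma nn_integral_spot_gamma:
  assumes t: "t < N" and k: "0 < k" and f [measurable]: "f \<in> borel_measurable borel"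
  shows "(\<integral>\<^sup>+x. f x * (ennreal (put_gamma \<kappa> t (Suc t) k (x - c)) * indicator {0<..} (x - c)) \<partial>lborel) =
    (\<integral>\<^sup>+v. f (k * v + c) \<partial>adjoint_return_law t)"
proof -
  let ?g = "\<lambda>y. put_gamma \<kappa> t (Suc t) 1 y * indicator {0<..} y"
  note borel_measurable_spot_gamma[OF t, measurable]
  have g: "ennreal (put_gamma \<kappa> t (Suc t) k y) * indicator {0<..} y = ennreal (?g (y / k) / k)" for y
    using put_gamma_homogeneous[OF t k, of y] k by (auto simp: indicator_def zero_less_divide_iff)
  have "(\<integral>\<^sup>+x. f x * (ennreal (put_gamma \<kappa> t (Suc t) k (x - c)) * indicator {0<..} (x - c)) \<partial>lborel) =
      (\<integral>\<^sup>+x. f x * ennreal (?g ((x - c) / k) / k) \<partial>lborel)"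
    unfolding g ..
  also have "\<dots> = ennreal \<bar>k\<bar> * (\<integral>\<^sup>+v. f (c + k * v) * ennreal (?g ((c + k * v - c) / k) / k) \<partial>lborel)"
    by (rule nn_integral_real_affine) (use k in auto)
  also have "\<dots> = (\<integral>\<^sup>+v. ennreal k * (f (c + k * v) * ennreal (?g v / k)) \<partial>lborel)"
    using k by (subst nn_integral_cmult[symmetric]) auto
  also have "\<dots> = (\<integral>\<^sup>+v. ennreal (?g v) * f (k * v + c) \<partial>lborel)"
  proof (rule nn_integral_cong)
    fix v
    have "ennreal k * ennreal (?g v / k) = ennreal (?g v)"
      using k by (subst ennreal_mult'[symmetric]) auto
    then show "ennreal k * (f (c + k * v) * ennreal (?g v / k)) = ennreal (?g v) * f (k * v + c)"
      by (metis add.commute mult.assoc mult.commute)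
  qed
  also have "\<dots> = (\<integral>\<^sup>+v. f (k * v + c) \<partial>density lborel (\<lambda>v. ennreal (?g v)))"
    by (subst nn_integral_density) auto
  also have "density lborel (\<lambda>v. ennreal (?g v)) = adjoint_return_law t"
    unfolding adjoint_return_law_def
    by (intro arg_cong[where f = "density lborel"] ext) (auto simp: indicator_def)
  finally show ?thesis .
qed

text \<open>Homogeneity reduces Gamma to a function of \<open>y / k\<close> alone. Joint
  measurability is needed to apply Fubini to the weights.\<close>

lemma borel_measurable_put_gamma:
  assumes t: "t < N"
  shows "(\<lambda>(k, y). ennreal (put_gamma \<kappa> t (Suc t) k y) * indicator {0<..} y * indicator {0<..} k)
    \<in> borel_measurable (borel \<Otimes>\<^sub>M borel)"
proof -
  let ?g = "\<lambda>y. put_gamma \<kappa> t (Suc t) 1 y * indicator {0<..} y"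
  note borel_measurable_spot_gamma[OF t, measurable]
  have "(\<lambda>(k, y). ennreal (put_gamma \<kappa> t (Suc t) k y) * indicator {0<..} y * indicator {0<..} k) =
      (\<lambda>(k, y). ennreal (?g (y / k) / k) * indicator {0<..} k)"
  proof (intro ext, clarify)
    fix k y :: real
    show "ennreal (put_gamma \<kappa> t (Suc t) k y) * indicator {0<..} y * indicator {0<..} k =
        ennreal (?g (y / k) / k) * indicator {0<..} k"
      using put_gamma_homogeneous[OF t, of k y] by (auto simp: indicator_def zero_less_divide_iff)
  qed
  also have "\<dots> \<in> borel_measurable (borel \<Otimes>\<^sub>M borel)"
    by measurable
  finally show ?thesis .
qed

text \<open>The adjoint process thus has independent returns too, with the time index
  reversed.\<close>

lemma adjoint_kernel_scaling:
  assumes j: "j < N" and k: "0 < k"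
  shows "adjoint_kernel N \<kappa> j (Suc j) k = distr (adjoint_return_law (N - Suc j)) borel ((*) k)"
proof (rule measure_eqI)
  fix A assume "A \<in> sets (adjoint_kernel N \<kappa> j (Suc j) k)"
  then have A [measurable]: "A \<in> sets borel"
    by (simp add: adjoint_kernel_def)
  define t where "t = N - Suc j"
  have t: "t < N" "N - j = Suc t"
    using j by (auto simp: t_def)
  have "(\<lambda>y. ennreal (put_gamma \<kappa> t (Suc t) k y) * indicator {0<..} y) \<in> borel_measurable lborel"
    using measurable_compose[OF measurable_Pair1'[of k borel] borel_measurable_put_gamma[OF t(1)]] k
    by simp
  note this [unfolded mult.commute[of "ennreal _"], measurable] this [measurable]
  have "emeasure (adjoint_kernel N \<kappa> j (Suc j) k) A =
      (\<integral>\<^sup>+x. indicator A x * (ennreal (put_gamma \<kappa> t (Suc t) k (x - 0)) * indicator {0<..} (x - 0)) \<partial>lborel)"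
    unfolding adjoint_kernel_def t(2) t_def[symmetric]
    by (subst emeasure_density) (auto intro!: nn_integral_cong simp: mult.commute)
  also have "\<dots> = (\<integral>\<^sup>+v. indicator A (k * v + 0) \<partial>adjoint_return_law t)"
    by (rule nn_integral_spot_gamma) (use t k in auto)
  also have "\<dots> = (\<integral>\<^sup>+x. indicator A x \<partial>distr (adjoint_return_law t) borel ((*) k))"
    by (subst nn_integral_distr) auto
  finally show "emeasure (adjoint_kernel N \<kappa> j (Suc j) k) A =
      emeasure (distr (adjoint_return_law (N - Suc j)) borel ((*) k)) A"
    by (simp add: t_def)
qed (simp add: adjoint_kernel_def)

end

section \<open>The law of the contribution fund and the weights\<close>

locale guarantee_model = reverse_adjoint_pair +
  fixes w x0 :: real
  assumes w: "0 < w" and x0: "0 < x0"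
begin

abbreviation "Y \<equiv> contribution_fund w S'"

lemma contribution_fund_0: "Y 0 = (\<lambda>_. w)"
  by auto

lemma contribution_fund_adapted:
  "j \<le> N \<Longrightarrow> Y j \<in> borel_measurable (natural_filtration M' S' j)"
proof (induction j)
  case (Suc j)
  then have [measurable]: "Y j \<in> borel_measurable (natural_filtration M' S' (Suc j))"
    "S' j \<in> borel_measurable (natural_filtration M' S' (Suc j))"
    "S' (Suc j) \<in> borel_measurable (natural_filtration M' S' (Suc j))"
    using adj.measurable_earlier[of _ j _ "Suc j"] adj.adapted[of j] adj.adapted[of "Suc j"] by auto
  show ?case by simp
qed (simp add: contribution_fund_0)

lemma contribution_fund_measurable: "j \<le> N \<Longrightarrow> Y j \<in> borel_measurable M'"
  by (rule adj.measurable_filtration[OF contribution_fund_adapted])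

lemma contribution_fund_ge:
  assumes "j \<le> N" "y \<in> space M'"
  shows "w \<le> Y j y"
  using assms(1)
proof (induction j)
  case (Suc j)
  then have "0 < S' (Suc j) y / S' j y" "w \<le> Y j y"
    using adj.positive[of _ y] assms(2) by auto
  then have "0 \<le> Y j y * (S' (Suc j) y / S' j y)"
    using w by (intro mult_nonneg_nonneg) auto
  then show ?case by simp
qed simp

text \<open>Indexed by asset time, like the weights, so that lowering \<open>t\<close> by one adds
  one contribution step.\<close>

definition contribution_law :: "nat \<Rightarrow> real measure" where
  "contribution_law t = distr M' borel (Y (N - Suc t))"

lemma sets_contribution_law [simp, measurable_cong]: "sets (contribution_law t) = sets borel"
  by (simp add: contribution_law_def)

lemma prob_space_contribution_law: "prob_space (contribution_law t)"
  unfolding contribution_law_def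
  by (intro adj.prob_space_distr contribution_fund_measurable) simp

lemma AE_contribution_law: "AE k in contribution_law t. w \<le> k"
  unfolding contribution_law_def
proof (subst AE_distr_iff)
  show "Y (N - Suc t) \<in> borel_measurable M'"
    by (rule contribution_fund_measurable) simp
  show "AE y in M'. w \<le> Y (N - Suc t) y"
    by (intro AE_I2 contribution_fund_ge) auto
qed simp

lemma contribution_law_last: "0 < N \<Longrightarrow> contribution_law (N - 1) = return borel w"
  by (simp add: contribution_law_def contribution_fund_0 adj.distr_const)

text \<open>With \<open>j = N - Suc (Suc t)\<close>, the fund moves from \<open>Y j\<close> to
  \<open>Y j * v + w\<close>, where the adjoint return \<open>v\<close> is independent of
  \<open>Y j\<close>.\<close>

lemma nn_integral_contribution_law_Suc:
  assumes t: "Suc t < N" and h [measurable]: "h \<in> borel_measurable borel"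
  shows "(\<integral>\<^sup>+k. h k \<partial>contribution_law t) =
    (\<integral>\<^sup>+k. \<integral>\<^sup>+v. h (k * v + w) \<partial>adjoint_return_law (Suc t) \<partial>contribution_law (Suc t))"
proof -
  define j where "j = N - Suc (Suc t)"
  have j: "N - Suc t = Suc j" "j < N" "N - Suc j = Suc t"
    using t by (auto simp: j_def)
  interpret \<mu>: positive_distribution "adjoint_return_law (Suc t)"
    by (rule positive_distribution_adjoint_return_law[OF t])
  have [measurable]: "Y j \<in> borel_measurable (natural_filtration M' S' j)"
    "Y (Suc j) \<in> borel_measurable M'" "Y j \<in> borel_measurable M'"
    using contribution_fund_adapted contribution_fund_measurable j by auto
  have "(\<integral>\<^sup>+k. h k \<partial>contribution_law t) = (\<integral>\<^sup>+y. h (Y (Suc j) y) \<partial>M')"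
    unfolding contribution_law_def j(1) by (rule nn_integral_distr) measurable
  also have "\<dots> = (\<integral>\<^sup>+y. (\<lambda>(y, v). h (Y j y * v + w)) (y, S' (Suc j) y / S' j y) \<partial>M')"
    by simp
  also have "\<dots> = (\<integral>\<^sup>+y. \<integral>\<^sup>+v. (\<lambda>(y, v). h (Y j y * v + w)) (y, v) \<partial>adjoint_return_law (Suc t) \<partial>M')"
    by (rule adj.nn_integral_independent_return)
      (use j adjoint_kernel_scaling[of j] \<mu>.prob_space_axioms in auto)
  also have "\<dots> = (\<integral>\<^sup>+k. \<integral>\<^sup>+v. h (k * v + w) \<partial>adjoint_return_law (Suc t) \<partial>contribution_law (Suc t))"
    unfolding contribution_law_def j_def[symmetric] by (subst nn_integral_distr) auto
  finally show ?thesis .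
qed

text \<open>Downward induction on \<open>t\<close>. For fixed \<open>k'\<close>, the Gamma in the
  recursion is the density of \<open>k' * v + w\<close>, with \<open>v\<close> the adjoint return;
  averaging over \<open>k'\<close> by Fubini is one step of the contribution fund.\<close>

lemma contribution_law_eq_weight:
  assumes "t < N"
  shows "contribution_law t = weight N w \<kappa> t"
  using assms
proof (induction t rule: measure_induct_rule[where f = "\<lambda>t. N - t"])
  case (less t)
  show ?case
  proof (cases "Suc t < N")
    case False
    then have "t = N - 1" using less.prems by simp
    then show ?thesis
      using contribution_law_last less.prems by (simp add: weight.simps)
  next
    case True
    let ?L = "contribution_law (Suc t)"
    have IH: "weight N w \<kappa> (Suc t) = ?L"
      using less.IH[of "Suc t"] True by simp
    interpret L: prob_space ?L
      by (rule prob_space_contribution_law)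
    interpret P: pair_sigma_finite lborel ?L ..
    \<comment> \<open>The cut-offs make Gamma jointly measurable. They change nothing here, since
      \<open>k \<ge> w > 0\<close> almost surely and the weight lives on spots above
      \<open>w\<close>.\<close>
    define \<Gamma> where "\<Gamma> k y = ennreal (put_gamma \<kappa> (Suc t) (Suc (Suc t)) k y) * indicator {0<..} y * indicator {0<..} k"
      for k y :: real
    have [measurable]: "(\<lambda>(k, y). \<Gamma> k y) \<in> borel_measurable (borel \<Otimes>\<^sub>M borel)"
      unfolding \<Gamma>_def by (rule borel_measurable_put_gamma[OF True])
    have wd: "weight_density w \<kappa> t ?L x * indicator {w<..} x = (\<integral>\<^sup>+k. \<Gamma> k (x - w) \<partial>?L)" for x
    proof (cases "w < x")
      case True
      have "weight_density w \<kappa> t ?L x = (\<integral>\<^sup>+k. \<Gamma> k (x - w) \<partial>?L)"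
        unfolding weight_density_def \<Gamma>_def
        by (rule nn_integral_cong_AE)
          (use AE_contribution_law[of "Suc t"] True w in \<open>auto elim!: eventually_mono\<close>)
      then show ?thesis using True by simp
    qed (simp add: \<Gamma>_def)
    have weight: "weight N w \<kappa> t = density lborel (\<lambda>x. \<integral>\<^sup>+k. \<Gamma> k (x - w) \<partial>?L)"
      using True IH by (subst weight.simps) (simp add: wd)
    show ?thesis
    proof (rule measure_eqI)
      fix A assume "A \<in> sets (contribution_law t)"
      then have [measurable]: "A \<in> sets borel" by simp
      have "emeasure (weight N w \<kappa> t) A = (\<integral>\<^sup>+x. (\<integral>\<^sup>+k. \<Gamma> k (x - w) \<partial>?L) * indicator A x \<partial>lborel)"
        unfolding weight by (subst emeasure_density) auto
      also have "\<dots> = (\<integral>\<^sup>+x. \<integral>\<^sup>+k. indicator A x * \<Gamma> k (x - w) \<partial>?L \<partial>lborel)"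
        by (subst nn_integral_multc[symmetric]) (auto simp: mult.commute)
      also have "\<dots> = (\<integral>\<^sup>+k. \<integral>\<^sup>+x. indicator A x * \<Gamma> k (x - w) \<partial>lborel \<partial>?L)"
        by (rule P.Fubini'[symmetric]) measurable
      also have "\<dots> = (\<integral>\<^sup>+k. \<integral>\<^sup>+v. indicator A (k * v + w) \<partial>adjoint_return_law (Suc t) \<partial>?L)"
      proof (rule nn_integral_cong_AE)
        show "AE k in ?L. (\<integral>\<^sup>+x. indicator A x * \<Gamma> k (x - w) \<partial>lborel) =
            (\<integral>\<^sup>+v. indicator A (k * v + w) \<partial>adjoint_return_law (Suc t))"
          using AE_contribution_law[of "Suc t"]
        proof eventually_elim
          case (elim k)
          then have "0 < k" using w by simp
          then show ?case
            using nn_integral_spot_gamma[OF True, of k "indicator A" w] by (simp add: \<Gamma>_def)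
        qed
      qed
      also have "\<dots> = (\<integral>\<^sup>+k. indicator A k \<partial>contribution_law t)"
        by (rule nn_integral_contribution_law_Suc[symmetric]) (use True in auto)
      finally show "emeasure (contribution_law t) A = emeasure (weight N w \<kappa> t) A"
        by simp
    qed (simp add: weight)
  qed
qed

text \<open>The adjoint return has mean 1, so every step adds \<open>w\<close> to the mean. Working
  with nonnegative integrals yields integrability together with the value.\<close>

lemma nn_integral_contribution_law_mean:
  assumes "t < N"
  shows "(\<integral>\<^sup>+k. ennreal k \<partial>contribution_law t) = ennreal (real (N - t) * w)"
  using assms
proof (induction t rule: measure_induct_rule[where f = "\<lambda>t. N - t"])
  case (less t)
  show ?case
  proof (cases "Suc t < N")
    case False
    then have "t = N - 1" using less.prems by simp
    then show ?thesis
      using contribution_law_last less.prems by (simp add: nn_integral_return)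
  next
    case True
    interpret L: prob_space "contribution_law (Suc t)"
      by (rule prob_space_contribution_law)
    interpret \<mu>: positive_distribution "adjoint_return_law (Suc t)"
      by (rule positive_distribution_adjoint_return_law[OF True])
    interpret \<nu>: positive_distribution "return_law (Suc t)"
      by (rule positive_distribution_return_law[OF True])
    \<comment> \<open>At \<open>k = 1\<close> and \<open>z = 0\<close> duality turns the mean
      adjoint return into the total mass of the return law.\<close>
    have v: "(\<integral>\<^sup>+v. ennreal v \<partial>adjoint_return_law (Suc t)) = 1"
      using put_call_duality[OF True, of 1 0] \<nu>.emeasure_space_1 by simp
    have "(\<integral>\<^sup>+k. ennreal k \<partial>contribution_law t) =
        (\<integral>\<^sup>+k. \<integral>\<^sup>+v. ennreal (k * v + w) \<partial>adjoint_return_law (Suc t) \<partial>contribution_law (Suc t))"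
      by (rule nn_integral_contribution_law_Suc[OF True]) simp
    also have "\<dots> = (\<integral>\<^sup>+k. ennreal k + ennreal w \<partial>contribution_law (Suc t))"
    proof (rule nn_integral_cong_AE)
      show "AE k in contribution_law (Suc t).
          (\<integral>\<^sup>+v. ennreal (k * v + w) \<partial>adjoint_return_law (Suc t)) = ennreal k + ennreal w"
        using AE_contribution_law[of "Suc t"]
      proof eventually_elim
        case (elim k)
        have "(\<integral>\<^sup>+v. ennreal (k * v + w) \<partial>adjoint_return_law (Suc t)) =
            (\<integral>\<^sup>+v. ennreal k * ennreal v + ennreal w \<partial>adjoint_return_law (Suc t))"
        proof (rule nn_integral_cong_AE)
          show "AE v in adjoint_return_law (Suc t). ennreal (k * v + w) = ennreal k * ennreal v + ennreal w"
            using \<mu>.AE_pos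
            by eventually_elim (use w elim in \<open>simp add: ennreal_mult ennreal_plus\<close>)
        qed
        also have "\<dots> = ennreal k + ennreal w"
          by (use \<mu>.emeasure_space_1 in \<open>simp add: nn_integral_add nn_integral_cmult v\<close>)
        finally show ?case .
      qed
    qed
    also have "\<dots> = ennreal (real (N - Suc t) * w) + ennreal w"
      using less.IH[of "Suc t"] True by (simp add: nn_integral_add L.emeasure_space_1)
    also have "\<dots> = ennreal (real (N - t) * w)"
    proof -
      have "real (N - t) = real (N - Suc t) + 1"
        using True by simp
      then show ?thesis
        using w by (subst ennreal_plus[symmetric]) (auto simp: algebra_simps simp del: of_nat_diff)
    qed
    finally show ?thesis .
  qed
qed

lemma
  assumes "t < N"
  shows integrable_contribution_law: "integrable (contribution_law t) (\<lambda>k. k)"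
    and contribution_law_mean: "(\<integral>k. k \<partial>contribution_law t) = real (N - t) * w"
proof -
  have nn: "AE k in contribution_law t. 0 \<le> k"
    using AE_contribution_law[of t] by eventually_elim (use w in simp)
  show *: "integrable (contribution_law t) (\<lambda>k. k)"
    using nn nn_integral_contribution_law_mean[OF assms] by (intro integrableI_nonneg) auto
  have "ennreal (\<integral>k. k \<partial>contribution_law t) = ennreal (real (N - t) * w)"
    using nn_integral_eq_integral[OF * nn] nn_integral_contribution_law_mean[OF assms] by simp
  moreover have "0 \<le> (\<integral>k. k \<partial>contribution_law t)"
    using nn by (rule integral_nonneg_AE)
  ultimately show "(\<integral>k. k \<partial>contribution_law t) = real (N - t) * w"
    using w ennreal_inj[of "\<integral>k. k \<partial>contribution_law t" "real (N - t) * w"] by simp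
qed

end

section \<open>The withdrawal guarantee\<close>

context guarantee_model
begin

abbreviation "X \<equiv> withdrawal_fund w x0 S"
abbreviation "\<tau> \<equiv> depletion_time N w x0 S"
abbreviation "Z \<equiv> guarantee_claim N w x0 S"

lemma withdrawal_fund_0: "X 0 = (\<lambda>_. x0)"
  by auto

lemma withdrawal_fund_adapted: "t \<le> N \<Longrightarrow> X t \<in> borel_measurable (F t)"
proof (induction t)
  case (Suc t)
  then have [measurable]: "X t \<in> borel_measurable (F (Suc t))"
    "S t \<in> borel_measurable (F (Suc t))" "S (Suc t) \<in> borel_measurable (F (Suc t))"
    using measurable_earlier[of _ t _ "Suc t"] adapted[of t] adapted[of "Suc t"] by auto
  show ?case by simp
qed (simp add: withdrawal_fund_0)

lemma withdrawal_fund_measurable: "t \<le> N \<Longrightarrow> X t \<in> borel_measurable M"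
  by (rule measurable_filtration[OF withdrawal_fund_adapted])

text \<open>In \<open>enat\<close> the infimum of a nonempty set is attained and that of the empty
  set is infinity, so \<open>\<tau>\<close> is a genuine first passage time.\<close>

lemma depletion_time_greater_iff:
  assumes "t \<le> N"
  shows "enat t < \<tau> x \<longleftrightarrow> (\<forall>u\<le>t. 0 < X u x)"
proof -
  have "\<tau> x \<le> enat t \<longleftrightarrow> (\<exists>u\<le>t. X u x \<le> 0)"
  proof
    assume le: "\<tau> x \<le> enat t"
    let ?A = "enat ` {u. u \<le> N \<and> X u x \<le> 0}"
    have ne: "?A \<noteq> {}"
    proof
      assume "?A = {}"
      then have "\<tau> x = Inf {}"
        unfolding depletion_time_def by (rule arg_cong)
      then show False
        using le by (simp add: top_enat_def)
    qed
    then obtain a where "a \<in> ?A" by blast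
    then have "(LEAST a. a \<in> ?A) \<in> ?A"
      by (rule LeastI)
    moreover have "\<tau> x = (LEAST a. a \<in> ?A)"
      unfolding depletion_time_def Inf_enat_def by (rule if_not_P[OF ne])
    ultimately have "\<tau> x \<in> ?A"
      by (simp only:)
    then show "\<exists>u\<le>t. X u x \<le> 0"
      using le by auto
  next
    assume "\<exists>u\<le>t. X u x \<le> 0"
    then obtain u where u: "u \<le> t" "X u x \<le> 0" by auto
    then have "\<tau> x \<le> enat u"
      unfolding depletion_time_def using assms by (intro Inf_lower) auto
    also have "\<dots> \<le> enat t" using u by simp
    finally show "\<tau> x \<le> enat t" .
  qed
  then show ?thesis
    by (metis not_le)
qed

lemma depletion_time_le_iff:
  assumes "t \<le> N"
  shows "\<tau> x \<le> enat t \<longleftrightarrow> (\<exists>u\<le>t. X u x \<le> 0)"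
  using depletion_time_greater_iff[OF assms, of x] by (metis not_le)

lemma depletion_time_eq_Suc_iff:
  assumes "Suc t \<le> N"
  shows "\<tau> x = enat (Suc t) \<longleftrightarrow> enat t < \<tau> x \<and> X (Suc t) x \<le> 0"
proof -
  have "\<tau> x = enat (Suc t) \<longleftrightarrow> enat t < \<tau> x \<and> \<tau> x \<le> enat (Suc t)"
    by (cases "\<tau> x") auto
  then show ?thesis
    using depletion_time_le_iff[OF assms, of x] depletion_time_greater_iff[of t x] assms
    by (metis Suc_leD le_Suc_eq not_le)
qed

text \<open>A return keeps a positive fund positive, so only the withdrawal can push it below zero
  and the shortfall is at most \<open>w\<close>. This bounds all claims.\<close>

lemma withdrawal_fund_Suc_ge:
  assumes "Suc t \<le> N" "x \<in> space M" "0 < X t x"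
  shows "- w \<le> X (Suc t) x"
proof -
  have "0 < S (Suc t) x / S t x"
    using positive[of _ x] assms by auto
  then have "0 \<le> X t x * (S (Suc t) x / S t x)"
    using assms by (intro mult_nonneg_nonneg) auto
  then show ?thesis by simp
qed

text \<open>While the fund is alive at \<open>t\<close>, a negative part at \<open>Suc t\<close> can
  occur only through depletion at that very time, so the two indicators merge into one case
  distinction.\<close>

lemma guarantee_claim_Suc:
  assumes "Suc t \<le> N"
  shows "Z (Suc t) x = (if \<tau> x \<le> enat t then w else max 0 (- X (Suc t) x))"
proof (cases "\<tau> x \<le> enat t")
  case False
  then show ?thesis
    using depletion_time_eq_Suc_iff[OF assms, of x] by (auto simp: guarantee_claim_def)
next
  case True
  then have "\<tau> x \<noteq> enat (Suc t)" by auto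
  then show ?thesis
    using True by (simp add: guarantee_claim_def)
qed

lemma guarantee_claim_before_depletion:
  assumes "t \<le> N" "enat t < \<tau> x"
  shows "Z t x = 0"
proof (cases t)
  case (Suc s)
  then have "enat s < \<tau> x" "0 < X t x"
    using assms depletion_time_greater_iff[OF assms(1), of x] by (auto intro: less_trans[of _ "enat t"])
  then show ?thesis
    using guarantee_claim_Suc[of s x] assms Suc by auto
qed (simp add: guarantee_claim_def)

lemma guarantee_claim_bounds:
  assumes "t \<le> N" "x \<in> space M"
  shows "0 \<le> Z t x" "Z t x \<le> w"
proof -
  have "0 \<le> Z t x \<and> Z t x \<le> w"
  proof (cases t)
    case (Suc s)
    have "- w \<le> X (Suc s) x" if "\<not> \<tau> x \<le> enat s"
      using that withdrawal_fund_Suc_ge[of s x] depletion_time_greater_iff[of s x] assms Suc by auto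
    then show ?thesis
      using guarantee_claim_Suc[of s x] assms Suc w by auto
  qed (use w in \<open>simp add: guarantee_claim_def\<close>)
  then show "0 \<le> Z t x" "Z t x \<le> w" by auto
qed

lemma sets_depletion_time_greater:
  assumes "t \<le> N"
  shows "{x \<in> space M. enat t < \<tau> x} \<in> sets (F t)"
proof -
  have sp: "space M = space (F t)"
    using subalgebra_F[OF assms] by (simp add: subalgebra_def)
  have "X u \<in> borel_measurable (F t)" if "u \<le> t" for u
    using that assms by (intro measurable_earlier[OF withdrawal_fund_adapted]) auto
  then have "{x \<in> space (F t). 0 < X u x} \<in> sets (F t)" if "u \<in> {..t}" for u
    using that by (auto intro: borel_measurable_less)
  then have "{x \<in> space (F t). \<forall>u\<in>{..t}. 0 < X u x} \<in> sets (F t)"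
    by (intro sets.sets_Collect_finite_All) auto
  moreover have "{x \<in> space M. enat t < \<tau> x} = {x \<in> space (F t). \<forall>u\<in>{..t}. 0 < X u x}"
    using depletion_time_greater_iff[OF assms] by (auto simp: sp)
  ultimately show ?thesis by simp
qed

lemma guarantee_claim_measurable:
  assumes "t \<le> N"
  shows "Z t \<in> borel_measurable M"
proof (cases t)
  case 0
  then have "Z t = (\<lambda>_. 0)" by (auto simp: guarantee_claim_def)
  then show ?thesis by simp
next
  case (Suc s)
  then have B: "{x \<in> space M. \<not> \<tau> x \<le> enat s} \<in> sets M"
    using sets_depletion_time_greater[of s] subalgebra_F[of s] assms
    by (auto simp: not_le subalgebra_def)
  have [measurable]: "Measurable.pred M (\<lambda>x. \<tau> x \<le> enat s)"
    using sets.sets_Collect_neg[OF B] by (simp add: pred_def)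
  note withdrawal_fund_measurable[OF assms, measurable]
  have "Z t = (\<lambda>x. if \<tau> x \<le> enat s then w else max 0 (- X t x))"
    using guarantee_claim_Suc[of s] assms Suc by auto
  then show ?thesis by simp
qed

definition total_claim :: "nat \<Rightarrow> 'a \<Rightarrow> real" where
  "total_claim t x = (\<Sum>u=t..N. Z u x)"

lemma total_claim_measurable: "total_claim t \<in> borel_measurable M"
  unfolding total_claim_def using guarantee_claim_measurable by (intro borel_measurable_sum) auto

lemma total_claim_nonneg: "x \<in> space M \<Longrightarrow> 0 \<le> total_claim t x"
  unfolding total_claim_def by (intro sum_nonneg guarantee_claim_bounds) auto

lemma integrable_total_claim: "integrable M (total_claim t)"
proof (rule integrable_const_bound)
  show "AE x in M. norm (total_claim t x) \<le> (\<Sum>u=t..N. w)"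
  proof (rule AE_I2)
    fix x assume "x \<in> space M"
    then have "total_claim t x \<le> (\<Sum>u=t..N. w)"
      unfolding total_claim_def by (intro sum_mono guarantee_claim_bounds) auto
    then show "norm (total_claim t x) \<le> (\<Sum>u=t..N. w)"
      using total_claim_nonneg[OF \<open>x \<in> space M\<close>, of t] by (simp only: real_norm_def abs_of_nonneg)
  qed
qed (rule total_claim_measurable)

lemma total_claim_Suc:
  assumes "Suc t \<le> N" "enat t < \<tau> x"
  shows "total_claim t x = total_claim (Suc t) x"
  using assms guarantee_claim_before_depletion[of t x]
  unfolding total_claim_def by (subst sum.atLeast_Suc_atMost) auto

text \<open>Depletion at \<open>Suc t\<close> pays the shortfall once, followed by
  \<open>N - Suc t\<close> claims of \<open>w\<close>: nothing beyond \<open>X (Suc t)\<close>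
  remains random.\<close>

lemma total_claim_depleted:
  assumes t: "Suc t \<le> N" and \<tau>: "enat t < \<tau> x" and X: "X (Suc t) x \<le> 0"
  shows "total_claim (Suc t) x = real (N - Suc t) * w - X (Suc t) x"
proof -
  have eq: "\<tau> x = enat (Suc t)"
    using depletion_time_eq_Suc_iff[OF t] \<tau> X by simp
  have later: "Z u x = w" if "u \<in> {Suc (Suc t)..N}" for u
  proof -
    obtain s where "u = Suc s" "Suc t \<le> s" "Suc s \<le> N"
      using \<open>u \<in> _\<close> by (cases u) auto
    then show ?thesis
      using guarantee_claim_Suc[of s x] eq by simp
  qed
  have "total_claim (Suc t) x = Z (Suc t) x + (\<Sum>u=Suc (Suc t)..N. Z u x)"
    unfolding total_claim_def by (rule sum.atLeast_Suc_atMost[OF t])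
  also have "(\<Sum>u=Suc (Suc t)..N. Z u x) = real (N - Suc t) * w"
    using later by simp
  also have "Z (Suc t) x = - X (Suc t) x"
    using guarantee_claim_Suc[OF t, of x] eq X by simp
  finally show ?thesis by simp
qed

text \<open>
  \<open>value_after t z\<close> is the value at time \<open>t + 1\<close> of all claims of a fund that is alive at time \<open>t\<close> and
  worth \<open>z\<close> at time \<open>t + 1\<close>, be \<open>z\<close> positive or not; \<open>value_before t z\<close> is the value at time \<open>t\<close>
  of a fund worth \<open>z\<close>. Positive parts are implicit in \<open>ennreal\<close>.
\<close>

definition value_after :: "nat \<Rightarrow> real \<Rightarrow> ennreal" where
  "value_after t z = (\<integral>\<^sup>+k. ennreal (k - w - z) \<partial>contribution_law t)"

definition value_before :: "nat \<Rightarrow> real \<Rightarrow> ennreal" where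
  "value_before t z = (\<integral>\<^sup>+r. value_after t (z * r - w) \<partial>return_law t)"

section \<open>Backward valuation of the claims\<close>

lemma value_after_measurable [measurable]: "value_after t \<in> borel_measurable borel"
proof -
  interpret prob: prob_space "contribution_law t"
    by (rule prob_space_contribution_law)
  show ?thesis unfolding value_after_def by measurable
qed

lemma value_before_measurable [measurable]:
  assumes "t < N"
  shows "value_before t \<in> borel_measurable borel"
proof -
  interpret \<nu>: positive_distribution "return_law t"
    by (rule positive_distribution_return_law[OF assms])
  show ?thesis unfolding value_before_def by measurable
qed

text \<open>The \<open>w\<close> subtracted in \<open>value_after\<close> cancels the withdrawal,
  since \<open>k - w - (z * r - w) = k - z * r\<close>. What remains is a mixture of put payoffs
  over the strike \<open>k\<close>.\<close>

lemma value_before_eq: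
  assumes "t < N"
  shows "value_before t z = (\<integral>\<^sup>+k. \<integral>\<^sup>+r. ennreal (k - z * r) \<partial>return_law t \<partial>contribution_law t)"
proof -
  interpret \<nu>: positive_distribution "return_law t"
    by (rule positive_distribution_return_law[OF assms])
  interpret L: prob_space "contribution_law t"
    by (rule prob_space_contribution_law)
  interpret P: pair_sigma_finite "return_law t" "contribution_law t" ..
  have "value_before t z = (\<integral>\<^sup>+r. \<integral>\<^sup>+k. ennreal (k - z * r) \<partial>contribution_law t \<partial>return_law t)"
    by (simp add: value_before_def value_after_def)
  also have "\<dots> = (\<integral>\<^sup>+k. \<integral>\<^sup>+r. ennreal (k - z * r) \<partial>return_law t \<partial>contribution_law t)"
    by (rule P.Fubini'[symmetric]) measurable
  finally show ?thesis .
qed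

text \<open>This drives the backward induction. Duality trades the asset return for an adjoint
  return, and \<open>k * v - z = (k * v + w) - w - z\<close> exhibits one more contribution
  step.\<close>

lemma value_before_Suc_eq_value_after:
  assumes "Suc t < N"
  shows "value_before (Suc t) z = value_after t z"
proof -
  have "value_before (Suc t) z =
      (\<integral>\<^sup>+k. \<integral>\<^sup>+v. ennreal (k * v + w - w - z) \<partial>adjoint_return_law (Suc t) \<partial>contribution_law (Suc t))"
    unfolding value_before_eq[OF assms] put_call_duality[OF assms, symmetric] by simp
  also have "\<dots> = value_after t z"
    unfolding value_after_def
    by (rule nn_integral_contribution_law_Suc[OF assms, symmetric]) simp
  finally show ?thesis .
qed

text \<open>Since \<open>k \<ge> w\<close> and \<open>z \<le> 0\<close>, the integrand is
  nonnegative, the positive part disappears and only the mean \<open>(N - t) * w\<close> enters. The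
  result agrees with the pathwise total claim of a depleted fund.\<close>

lemma value_after_nonpos:
  assumes "t < N" "z \<le> 0"
  shows "value_after t z = ennreal (real (N - Suc t) * w - z)"
proof -
  interpret L: prob_space "contribution_law t"
    by (rule prob_space_contribution_law)
  have "value_after t z = ennreal (\<integral>k. k - w - z \<partial>contribution_law t)"
    unfolding value_after_def
    by (rule nn_integral_eq_integral)
      (use integrable_contribution_law[OF assms(1)] AE_contribution_law[of t] assms
        in \<open>auto elim!: eventually_mono\<close>)
  also have "(\<integral>k. k - w - z \<partial>contribution_law t) = real (N - t) * w - w - z"
    using integrable_contribution_law[OF assms(1)] contribution_law_mean[OF assms(1)]
    by (simp add: L.prob_space)
  also have "\<dots> = real (N - Suc t) * w - z"
  proof -
    have "real (N - t) = real (N - Suc t) + 1"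
      using assms by simp
    then show ?thesis by (simp add: algebra_simps del: of_nat_diff)
  qed
  finally show ?thesis .
qed

text \<open>By independence of the return, \<open>value_before t (X t)\<close> is the conditional
  expectation of \<open>value_after t (X (Suc t))\<close>, here tested on events of
  \<open>F t\<close>.\<close>

lemma set_nn_integral_value_step:
  assumes t: "t < N" and A [measurable]: "A \<in> sets (F t)"
  shows "(\<integral>\<^sup>+x\<in>A. value_after t (X (Suc t) x) \<partial>M) = (\<integral>\<^sup>+x\<in>A. value_before t (X t x) \<partial>M)"
proof -
  interpret \<nu>: positive_distribution "return_law t"
    by (rule positive_distribution_return_law[OF t])
  have [measurable]: "X t \<in> borel_measurable (F t)"
    using withdrawal_fund_adapted t by simp
  let ?h = "\<lambda>(x, r). value_after t (X t x * r - w) * indicator A x"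
  have "(\<integral>\<^sup>+x\<in>A. value_after t (X (Suc t) x) \<partial>M) = (\<integral>\<^sup>+x. ?h (x, S (Suc t) x / S t x) \<partial>M)"
    by simp
  also have "\<dots> = (\<integral>\<^sup>+x. \<integral>\<^sup>+r. ?h (x, r) \<partial>return_law t \<partial>M)"
    by (rule nn_integral_independent_return)
      (use t kernel_scaling \<nu>.prob_space_axioms in auto)
  also have "\<dots> = (\<integral>\<^sup>+x\<in>A. value_before t (X t x) \<partial>M)"
    unfolding value_before_def by (simp add: nn_integral_multc)
  finally show ?thesis .
qed

text \<open>Downward induction on \<open>t\<close>, splitting by the sign of
  \<open>X (Suc t)\<close>. A depleted fund has the right value pathwise; a surviving one is valued
  by the induction hypothesis one step later, then brought back by
  \<open>set_nn_integral_value_step\<close> and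
  \<open>value_before_Suc_eq_value_after\<close>.\<close>

lemma set_nn_integral_total_claim_after:
  assumes "t < N" and A: "A \<in> sets (F t)" and \<tau>: "\<And>x. x \<in> A \<Longrightarrow> enat t < \<tau> x"
  shows "(\<integral>\<^sup>+x\<in>A. ennreal (total_claim t x) \<partial>M) = (\<integral>\<^sup>+x\<in>A. value_after t (X (Suc t) x) \<partial>M)"
  using assms
proof (induction t arbitrary: A rule: measure_induct_rule[where f = "\<lambda>t. N - t"])
  case (less t)
  have depleted: "ennreal (total_claim t x) = value_after t (X (Suc t) x)"
    if "x \<in> A" "X (Suc t) x \<le> 0" for x
    using that less.prems total_claim_Suc[of t x] total_claim_depleted[of t x] value_after_nonpos[of t]
    by auto
  show ?case
  proof (cases "Suc t < N")
    case False
    \<comment> \<open>At the last step \<open>contribution_law t\<close> is the point mass at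
      \<open>w\<close>, so \<open>value_after t z\<close> is the positive part of
      \<open>- z\<close>.\<close>
    then have last: "t = N - 1" "Suc t = N" using less.prems by auto
    have "ennreal (total_claim t x) = value_after t (X (Suc t) x)" if "x \<in> A" for x
    proof (cases "X (Suc t) x \<le> 0")
      case True
      then show ?thesis using depleted that by simp
    next
      case False
      then have "enat (Suc t) < \<tau> x"
        using less.prems(3)[OF that] depletion_time_greater_iff[of t x] depletion_time_greater_iff[of "Suc t" x]
          less.prems(1) by (auto simp: le_Suc_eq)
      then have "total_claim t x = 0"
        using total_claim_Suc[of t x] less.prems that guarantee_claim_before_depletion[of "Suc t" x] last
        by (simp add: total_claim_def)
      moreover have "value_after t (X (Suc t) x) = 0"
        using False contribution_law_last less.prems(1) last(1)
        by (simp add: value_after_def nn_integral_return ennreal_neg)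
      ultimately show ?thesis by simp
    qed
    then show ?thesis
      by (intro nn_integral_cong) (auto split: split_indicator)
  next
    case True
    let ?A1 = "A \<inter> {x \<in> space M. 0 < X (Suc t) x}" and ?A2 = "A \<inter> {x \<in> space M. X (Suc t) x \<le> 0}"
    have sp: "space (F (Suc t)) = space M"
      using subalgebra_F[of "Suc t"] True by (simp add: subalgebra_def)
    have AF [measurable]: "A \<in> sets (F (Suc t))"
      using F_mono[of t "Suc t"] less.prems True by (auto simp: subalgebra_def)
    have [measurable]: "X (Suc t) \<in> borel_measurable (F (Suc t))"
      using withdrawal_fund_adapted True by simp
    have XM [measurable]: "X (Suc t) \<in> borel_measurable M" "X (Suc (Suc t)) \<in> borel_measurable M"
      using withdrawal_fund_measurable True by auto
    have A1: "?A1 \<in> sets (F (Suc t))"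
      unfolding sp[symmetric] by measurable
    have AM [measurable]: "A \<in> sets M"
      using subalgebra_F[of t] less.prems by (auto simp: subalgebra_def)
    have [measurable]: "total_claim t \<in> borel_measurable M"
      by (rule total_claim_measurable)
    have A12: "?A1 \<in> sets M" "?A2 \<in> sets M"
      by measurable
    have \<tau>1: "enat (Suc t) < \<tau> x" if "x \<in> ?A1" for x
      using that less.prems(3)[of x] depletion_time_greater_iff[of t x]
        depletion_time_greater_iff[of "Suc t" x] True by (auto simp: le_Suc_eq)
    have split: "(\<integral>\<^sup>+x\<in>A. f x \<partial>M) = (\<integral>\<^sup>+x\<in>?A1. f x \<partial>M) + (\<integral>\<^sup>+x\<in>?A2. f x \<partial>M)"
      if [measurable]: "f \<in> borel_measurable M" for f
    proof -
      have "(\<integral>\<^sup>+x\<in>A. f x \<partial>M) = (\<integral>\<^sup>+x. f x * indicator ?A1 x + f x * indicator ?A2 x \<partial>M)"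
        by (intro nn_integral_cong) (auto split: split_indicator)
      also have "\<dots> = (\<integral>\<^sup>+x\<in>?A1. f x \<partial>M) + (\<integral>\<^sup>+x\<in>?A2. f x \<partial>M)"
        by (rule nn_integral_add) (intro borel_measurable_times_ennreal borel_measurable_indicator that A12)+
      finally show ?thesis .
    qed
    have "(\<integral>\<^sup>+x\<in>?A1. ennreal (total_claim t x) \<partial>M) = (\<integral>\<^sup>+x\<in>?A1. ennreal (total_claim (Suc t) x) \<partial>M)"
      using less.prems total_claim_Suc[of t] by (intro nn_integral_cong) (auto split: split_indicator)
    also have "\<dots> = (\<integral>\<^sup>+x\<in>?A1. value_after (Suc t) (X (Suc (Suc t)) x) \<partial>M)"
      by (rule less.IH) (use True A1 \<tau>1 in auto)
    also have "\<dots> = (\<integral>\<^sup>+x\<in>?A1. value_after t (X (Suc t) x) \<partial>M)"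
      using set_nn_integral_value_step[OF True A1] value_before_Suc_eq_value_after[OF True] by simp
    finally have 1: "(\<integral>\<^sup>+x\<in>?A1. ennreal (total_claim t x) \<partial>M) =
        (\<integral>\<^sup>+x\<in>?A1. value_after t (X (Suc t) x) \<partial>M)" .
    have 2: "(\<integral>\<^sup>+x\<in>?A2. ennreal (total_claim t x) \<partial>M) = (\<integral>\<^sup>+x\<in>?A2. value_after t (X (Suc t) x) \<partial>M)"
      using depleted by (intro nn_integral_cong) (auto split: split_indicator)
    have "(\<lambda>x. ennreal (total_claim t x)) \<in> borel_measurable M"
      "(\<lambda>x. value_after t (X (Suc t) x)) \<in> borel_measurable M"
      by measurable
    then show ?thesis
      by (simp only: split 1 2)
  qed
qed

text \<open>At a positive spot the inner integral of \<open>value_before_eq\<close> is a put value.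
  The bound of the put by \<open>\<bar>k\<bar>\<close> and the finite mean of the strike make the
  mixture integrable.\<close>

lemma put_value_contribution_law:
  assumes t: "t < N" and z: "0 < z"
  shows "integrable (contribution_law t) (\<lambda>k. put_value \<kappa> t (Suc t) k z)"
    and "value_before t z = ennreal (\<integral>k. put_value \<kappa> t (Suc t) k z \<partial>contribution_law t)"
    and "(\<lambda>k. put_value \<kappa> t (Suc t) k z) \<in> borel_measurable borel"
proof -
  interpret \<nu>: positive_distribution "return_law t"
    by (rule positive_distribution_return_law[OF t])
  interpret L: prob_space "contribution_law t"
    by (rule prob_space_contribution_law)
  note put = put_value_eq[OF t z]
  show meas [measurable]: "(\<lambda>k. put_value \<kappa> t (Suc t) k z) \<in> borel_measurable borel"
    unfolding put by measurable
  have int: "integrable (return_law t) (\<lambda>u. max 0 (k - z * u))" for k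
    using \<nu>.integrable_put z by simp
  have le: "put_value \<kappa> t (Suc t) k z \<le> \<bar>k\<bar>" for k
    unfolding put
  proof (rule \<nu>.integral_le_const[OF int])
    show "AE u in return_law t. max 0 (k - z * u) \<le> \<bar>k\<bar>"
      using \<nu>.AE_pos
    proof eventually_elim
      case (elim u)
      then have "0 < z * u" using z by simp
      then show ?case by simp
    qed
  qed
  show *: "integrable (contribution_law t) (\<lambda>k. put_value \<kappa> t (Suc t) k z)"
    by (rule Bochner_Integration.integrable_bound[OF integrable_contribution_law[OF t]])
      (use put_value_nonneg le in auto)
  have "(\<integral>\<^sup>+r. ennreal (k - z * r) \<partial>return_law t) = ennreal (put_value \<kappa> t (Suc t) k z)" for k
  proof -
    have "(\<integral>\<^sup>+r. ennreal (k - z * r) \<partial>return_law t) = (\<integral>\<^sup>+r. ennreal (max 0 (k - z * r)) \<partial>return_law t)"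
      by (intro nn_integral_cong) (simp add: max_def ennreal_neg)
    also have "\<dots> = ennreal (put_value \<kappa> t (Suc t) k z)"
      unfolding put by (rule nn_integral_eq_integral[OF int]) simp
    finally show ?thesis .
  qed
  then have "value_before t z = (\<integral>\<^sup>+k. ennreal (put_value \<kappa> t (Suc t) k z) \<partial>contribution_law t)"
    by (simp add: value_before_eq[OF t])
  also have "\<dots> = ennreal (\<integral>k. put_value \<kappa> t (Suc t) k z \<partial>contribution_law t)"
    by (rule nn_integral_eq_integral[OF *]) (use put_value_nonneg in simp)
  finally show "value_before t z = ennreal (\<integral>k. put_value \<kappa> t (Suc t) k z \<partial>contribution_law t)" .
qed

text \<open>Survival up to \<open>t\<close> is an event of \<open>F t\<close>, so both sides may be
  multiplied by its indicator and compared through integrals over events of \<open>F t\<close>. On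
  survival the value is finite, so \<open>enn2real\<close> loses nothing.\<close>

lemma guarantee_value_eq:
  assumes t: "t < N"
  shows "AE x in M. enat t < \<tau> x \<longrightarrow>
    guarantee_value M F N w x0 S t x = enn2real (value_before t (X t x))"
proof -
  interpret Ft: finite_measure_subalgebra M "F t"
    by unfold_locales (use subalgebra_F t in auto)
  let ?B = "{x \<in> space M. enat t < \<tau> x}"
  have B [measurable]: "?B \<in> sets (F t)"
    using sets_depletion_time_greater t by simp
  have B' [measurable]: "?B \<in> sets M"
    using B Ft.subalg by (auto simp: subalgebra_def)
  have XF [measurable]: "X t \<in> borel_measurable (F t)"
    using withdrawal_fund_adapted t by simp
  have [measurable]: "X t \<in> borel_measurable M"
    using withdrawal_fund_measurable t by simp
  note value_before_measurable[OF t, measurable] total_claim_measurable[measurable]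
  let ?f = "\<lambda>x. indicator ?B x * total_claim t x"
  let ?g = "\<lambda>x. indicator ?B x * enn2real (value_before t (X t x))"
  have f_int: "integrable M ?f"
    using integrable_mult_indicator[OF B' integrable_total_claim] by simp
  have nn: "(\<integral>\<^sup>+x. ennreal (indicator A x * ?f x) \<partial>M) = (\<integral>\<^sup>+x. ennreal (indicator A x * ?g x) \<partial>M)"
    if A: "A \<in> sets (F t)" for A
  proof -
    have finite: "value_before t (X t x) < \<infinity>" if "x \<in> ?B" for x
      using put_value_contribution_law(2)[OF t] depletion_time_greater_iff[of t x] that t by auto
    have "(\<integral>\<^sup>+x. ennreal (indicator A x * ?f x) \<partial>M) = (\<integral>\<^sup>+x\<in>A \<inter> ?B. ennreal (total_claim t x) \<partial>M)"
      by (intro nn_integral_cong) (auto split: split_indicator)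
    also have "\<dots> = (\<integral>\<^sup>+x\<in>A \<inter> ?B. value_before t (X t x) \<partial>M)"
    proof -
      have AB: "A \<inter> ?B \<in> sets (F t)"
        using A B by (rule sets.Int)
      show ?thesis
        unfolding set_nn_integral_value_step[OF t AB, symmetric]
        by (rule set_nn_integral_total_claim_after[OF t AB]) simp
    qed
    also have "\<dots> = (\<integral>\<^sup>+x. ennreal (indicator A x * ?g x) \<partial>M)"
      using finite by (intro nn_integral_cong) (auto split: split_indicator)
    finally show ?thesis .
  qed
  have nonneg: "AE x in M. 0 \<le> indicator A x * ?f x" for A
    using total_claim_nonneg by (intro AE_I2) (auto split: split_indicator)
  \<comment> \<open>Taking \<open>A\<close> as the survival event in \<open>nn\<close> gives
    \<open>?g\<close> the same finite integral as \<open>?f\<close>.\<close>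
  have g_int: "integrable M ?g"
  proof (rule integrableI_nonneg)
    have "(\<integral>\<^sup>+x. ennreal (?g x) \<partial>M) = (\<integral>\<^sup>+x. ennreal (indicator ?B x * ?g x) \<partial>M)"
      by (rule nn_integral_cong) (auto split: split_indicator)
    also have "\<dots> = (\<integral>\<^sup>+x. ennreal (indicator ?B x * ?f x) \<partial>M)"
      by (rule nn[OF B, symmetric])
    also have "\<dots> = (\<integral>\<^sup>+x. ennreal (?f x) \<partial>M)"
      by (rule nn_integral_cong) (auto split: split_indicator)
    finally have "(\<integral>\<^sup>+x. ennreal (?g x) \<partial>M) = (\<integral>\<^sup>+x. ennreal (?f x) \<partial>M)" .
    then show "(\<integral>\<^sup>+x. ennreal (?g x) \<partial>M) < \<infinity>"
      using nn_integral_eq_integral[OF f_int] nonneg[of UNIV] by (simp del: withdrawal_fund.simps)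
  qed auto
  have "AE x in M. real_cond_exp M (F t) ?f x = ?g x"
  proof (rule Ft.real_cond_exp_charact[OF _ f_int g_int])
    fix A assume A: "A \<in> sets (F t)"
    then have AM [measurable]: "A \<in> sets M"
      using Ft.subalg by (auto simp: subalgebra_def)
    show "(\<integral>x\<in>A. ?f x \<partial>M) = (\<integral>x\<in>A. ?g x \<partial>M)"
      unfolding set_lebesgue_integral_def real_scaleR_def
      by (subst (1 2) integral_eq_nn_integral) (use nonneg nn[OF A] in auto)
  qed measurable
  \<comment> \<open>The survival indicator is \<open>F t\<close>-measurable and comes out of the
    conditional expectation.\<close>
  moreover have "AE x in M. real_cond_exp M (F t) ?f x =
      indicator ?B x * real_cond_exp M (F t) (total_claim t) x"
    by (rule Ft.real_cond_exp_mult) (use f_int in measurable)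
  ultimately show ?thesis
    using AE_space
  proof eventually_elim
    case (elim x)
    then show ?case
      by (auto simp: guarantee_value_def total_claim_def[abs_def])
  qed
qed

end

section \<open>Restriction of integrals to the support of the contribution law\<close>

context guarantee_model
begin

lemma set_integral_contribution_law:
  assumes [measurable]: "f \<in> borel_measurable borel"
  shows "(LINT k:{w..}|contribution_law t. f k) = (\<integral>k. f k \<partial>contribution_law t)"
  unfolding set_lebesgue_integral_def
proof (rule integral_cong_AE)
  show "AE k in contribution_law t. indicator {w..} k *\<^sub>R f k = f k"
    using AE_contribution_law[of t] by eventually_elim simp
qed simp_all

lemma set_integrable_contribution_law:
  fixes f :: "real \<Rightarrow> real"
  assumes "integrable (contribution_law t) f"
  shows "set_integrable (contribution_law t) {w..} f"
  unfolding set_integrable_def using assms by (intro integrable_mult_indicator) auto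

lemma emeasure_contribution_law: "emeasure (contribution_law t) {w..} = 1"
proof -
  interpret L: prob_space "contribution_law t"
    by (rule prob_space_contribution_law)
  show ?thesis
    using AE_contribution_law[of t] by (intro L.emeasure_eq_1_AE) auto
qed

end

theorem mainTheorem3:
  fixes M :: "'a measure" and F :: "nat \<Rightarrow> 'a measure" and S :: "nat \<Rightarrow> 'a \<Rightarrow> real"
    and \<kappa> :: "nat \<Rightarrow> nat \<Rightarrow> real \<Rightarrow> real measure"
    and M' :: "'b measure" and S' :: "nat \<Rightarrow> 'b \<Rightarrow> real"
    and N :: nat and w x0 :: real
  defines "X \<equiv> withdrawal_fund w x0 S"
    and "\<tau> \<equiv> depletion_time N w x0 S"
    and "V \<equiv> guarantee_value M F N w x0 S"
    and "g \<equiv> weight N w \<kappa>"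
    and "Y \<equiv> contribution_fund w S'"
  assumes "N \<ge> 2" and "w > 0" and "x0 > 0"
    and "\<And>x. x \<in> space M \<Longrightarrow> S 0 x = 1"
    and "martingale_upto M F N S"
    and "A1 M F N S \<kappa>"
    and "A2 N \<kappa>"
    and "reverse_gamma_adjoint M' N S' \<kappa>"
  shows "(\<forall>t<N.
           distr M' borel (Y (N - t - 1)) = g t \<and>
           prob_space (g t) \<and> emeasure (g t) {w..} = 1 \<and>
           set_integrable (g t) {w..} (\<lambda>k. k) \<and>
           integrable M' (Y (N - t - 1)) \<and>
           (LINT k:{w..}|g t. k) = (\<integral>y. Y (N - t - 1) y \<partial>M') \<and>
           (\<integral>y. Y (N - t - 1) y \<partial>M') = real (N - t) * w) \<and>
         (\<forall>t<N. AE x in M. \<tau> x > enat t \<longrightarrow>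
           set_integrable (distr M' borel (Y (N - t - 1))) {w..}
             (\<lambda>k. put_value \<kappa> t (t + 1) k (X t x)) \<and>
           integrable M' (\<lambda>y. put_value \<kappa> t (t + 1) (Y (N - t - 1) y) (X t x)) \<and>
           V t x = (LINT k:{w..}|distr M' borel (Y (N - t - 1)). put_value \<kappa> t (t + 1) k (X t x)) \<and>
           (LINT k:{w..}|distr M' borel (Y (N - t - 1)). put_value \<kappa> t (t + 1) k (X t x))
             = (\<integral>y. put_value \<kappa> t (t + 1) (Y (N - t - 1) y) (X t x) \<partial>M'))"
proof -
  interpret guarantee_model M F N S \<kappa> M' S' w x0
    by unfold_locales fact+
  have law: "distr M' borel (Y (N - t - 1)) = contribution_law t" for t
    by (simp add: contribution_law_def Y_def)
  have Y_meas: "Y (N - t - 1) \<in> borel_measurable M'" for t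
    unfolding Y_def by (rule contribution_fund_measurable) simp
  have integral: "(\<integral>k. f k \<partial>contribution_law t) = (\<integral>y. f (Y (N - t - 1) y) \<partial>M')"
    and integrable: "integrable (contribution_law t) f \<longleftrightarrow> integrable M' (\<lambda>y. f (Y (N - t - 1) y))"
    if "f \<in> borel_measurable borel" for f :: "real \<Rightarrow> real" and t
    unfolding law[symmetric] using that Y_meas by (auto intro!: integral_distr integrable_distr_eq)
  have "distr M' borel (Y (N - t - 1)) = g t \<and>
      prob_space (g t) \<and> emeasure (g t) {w..} = 1 \<and>
      set_integrable (g t) {w..} (\<lambda>k. k) \<and>
      integrable M' (Y (N - t - 1)) \<and>
      (LINT k:{w..}|g t. k) = (\<integral>y. Y (N - t - 1) y \<partial>M') \<and>
      (\<integral>y. Y (N - t - 1) y \<partial>M') = real (N - t) * w" if t: "t < N" for t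
  proof -
    have g: "g t = contribution_law t"
      unfolding g_def by (rule contribution_law_eq_weight[OF t, symmetric])
    have id: "(\<lambda>k::real. k) \<in> borel_measurable borel" by simp
    show ?thesis
      unfolding law g set_integral_contribution_law[OF id] integral[OF id, symmetric]
      by (intro conjI refl prob_space_contribution_law emeasure_contribution_law
          set_integrable_contribution_law integrable_contribution_law contribution_law_mean t
          integrable[OF id, THEN iffD1])
  qed
  moreover have "AE x in M. \<tau> x > enat t \<longrightarrow>
      set_integrable (distr M' borel (Y (N - t - 1))) {w..} (\<lambda>k. put_value \<kappa> t (t + 1) k (X t x)) \<and>
      integrable M' (\<lambda>y. put_value \<kappa> t (t + 1) (Y (N - t - 1) y) (X t x)) \<and>
      V t x = (LINT k:{w..}|distr M' borel (Y (N - t - 1)). put_value \<kappa> t (t + 1) k (X t x)) \<and>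
      (LINT k:{w..}|distr M' borel (Y (N - t - 1)). put_value \<kappa> t (t + 1) k (X t x))
        = (\<integral>y. put_value \<kappa> t (t + 1) (Y (N - t - 1) y) (X t x) \<partial>M')" if t: "t < N" for t
    using guarantee_value_eq[OF t]
  proof eventually_elim
    case (elim x)
    show ?case
    proof
      assume \<tau>: "\<tau> x > enat t"
      have X: "0 < X t x"
        using depletion_time_greater_iff[OF less_imp_le[OF t], THEN iffD1, of x] \<tau>
        unfolding X_def \<tau>_def by blast
      note put = put_value_contribution_law[OF t X]
      have nonneg: "0 \<le> (\<integral>k. put_value \<kappa> t (Suc t) k (X t x) \<partial>contribution_law t)"
        by (intro Bochner_Integration.integral_nonneg put_value_nonneg)
      have "V t x = (\<integral>k. put_value \<kappa> t (Suc t) k (X t x) \<partial>contribution_law t)"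
        using elim \<tau> put(2) nonneg unfolding V_def X_def \<tau>_def by simp
      then show "set_integrable (distr M' borel (Y (N - t - 1))) {w..} (\<lambda>k. put_value \<kappa> t (t + 1) k (X t x)) \<and>
          integrable M' (\<lambda>y. put_value \<kappa> t (t + 1) (Y (N - t - 1) y) (X t x)) \<and>
          V t x = (LINT k:{w..}|distr M' borel (Y (N - t - 1)). put_value \<kappa> t (t + 1) k (X t x)) \<and>
          (LINT k:{w..}|distr M' borel (Y (N - t - 1)). put_value \<kappa> t (t + 1) k (X t x))
            = (\<integral>y. put_value \<kappa> t (t + 1) (Y (N - t - 1) y) (X t x) \<partial>M')"
        unfolding law Suc_eq_plus1[symmetric] set_integral_contribution_law[OF put(3)]
        using set_integrable_contribution_law[OF put(1)] integrable[OF put(3), of t]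
          integral[OF put(3), of t] put(1)
        by blast
    qed
  qed
  ultimately show ?thesis by blast
qed

end
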